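(* Let $n$ be a positive integer and let $\psi:\mathbb{N}\to(0,\infty)$ be a non-increasing function such that $\sum_{j\ge1}\psi(j)^n=\infty$. Then for almost every real $2n$-tuple $(\theta_1,\dots,\theta_n,y_1,\dots,y_n)\in\mathbb{R}^{2n}$ there exist infinitely many integer points $(q,p_1,\dots,p_n)\in\mathbb{Z}^{n+1}$ with $q\ne0$ such that $$\gcd(q,p_1,\dots,p_n)=1\quad\text{and}\quad \max_{1\le i\le n}|q\theta_i+p_i-y_i|\le\psi(|q|).$$
   Context: $\mathbb{N}=\{1,2,\dots\}$; "almost every" refers to Lebesgue measure. *)

theory Defs
  imports "HOL-Analysis.Analysis"
begin

end

theory Submission
  imports Defs "HOL-Number_Theory.Totient" "HOL-Real_Asymp.Real_Asymp"
begin

text \<open>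
  Fix a cube with sides of length \<open>1/N\<close>, \<open>N = 2\<^sup>k\<close>, and use only denominators \<open>q = N\<^sup>2 m\<close> with
  \<open>m \<equiv> 1 (mod 2N)\<close>. In each coordinate the condition that \<open>q x - y\<close> is within \<open>r\<close> of an integer is
  invariant under translation by \<open>(1/N, 0)\<close> and \<open>(1/N\<^sup>3, 1/N)\<close>, so two such conditions with different
  \<open>q\<close> are exactly independent on every cube, not only on the torus. Requiring the integer to be coprime
  to \<open>q\<close> keeps the invariance under \<open>(1/N, 0)\<close> and costs a factor \<open>\<phi>(q)/q\<close>, which is at least
  \<open>1/4\<close> for a positive proportion of the \<open>m\<close>; this proportion suffices for divergence because
  \<open>\<psi>\<close> is monotone. The second moment method then shows that the limsup set occupies a proportion of
  every dyadic cube that is bounded below by a constant depending only on \<open>n\<close>, and a set with this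
  property has full measure.
\<close>

subsection \<open>Periodic functions\<close>

text \<open>Independence on the whole torus alone would give a limsup set of positive measure, not
  of full measure; running the same estimate inside an arbitrarily small cube, with a constant
  independent of the cube, closes this gap. The shape of q comes from the translations: q/N = N m is
  an integer, and q/N^3 - 1/N = (m - 1)/N is one because N divides m - 1. The extra factor 2 in the
  congruence keeps m odd when N = 1. Demanding gcd(p_i, q) = 1 for every i is stronger than
  primitivity, but it makes each event a product over coordinates and treats n = 1 like every other
  n. The translation by (1/N^3, 1/N) changes p and in general destroys coprimality. Lower bounds for
  single events therefore keep coprimality and rely on integration in x alone, while upper bounds
  for intersections drop it. The loss is at most 4^n per event, which leads to the proportion
  (4^(-n))^2 / 4 in each cube.\<close>

lemma nn_integral_Ico_translate:
  fixes f :: "real \<Rightarrow> ennreal"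
  assumes [measurable]: "f \<in> borel_measurable borel"
  shows "(\<integral>\<^sup>+x\<in>{a + c..<b + c}. f x \<partial>lborel) = (\<integral>\<^sup>+x\<in>{a..<b}. f (x + c) \<partial>lborel)"
proof -
  have ind: "indicator {a + c..<b + c} (c + x) = (indicator {a..<b} x :: ennreal)" for x
    by (auto simp: indicator_def)
  show ?thesis
    by (subst nn_integral_real_affine[where c = 1 and t = c]) (simp_all add: ind, simp add: add.commute)
qed

lemma nn_integral_Ico_split:
  fixes f :: "real \<Rightarrow> ennreal"
  assumes [measurable]: "f \<in> borel_measurable borel" and "a \<le> b" "b \<le> c"
  shows "(\<integral>\<^sup>+x\<in>{a..<c}. f x \<partial>lborel) =
    (\<integral>\<^sup>+x\<in>{a..<b}. f x \<partial>lborel) + (\<integral>\<^sup>+x\<in>{b..<c}. f x \<partial>lborel)"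
proof -
  have "f x * indicator {a..<c} x = f x * indicator {a..<b} x + f x * indicator {b..<c} x" for x
    using assms by (auto simp: indicator_def)
  then show ?thesis
    by (simp add: nn_integral_add)
qed

lemma nn_integral_Icc_eq_Ico:
  fixes f :: "real \<Rightarrow> ennreal"
  shows "(\<integral>\<^sup>+x\<in>{a..b}. f x \<partial>lborel) = (\<integral>\<^sup>+x\<in>{a..<b}. f x \<partial>lborel)"
proof (rule nn_integral_cong_AE)
  show "AE x in lborel. f x * indicator {a..b} x = f x * indicator {a..<b} x"
    using AE_lborel_singleton[of b] by eventually_elim (auto simp: indicator_def)
qed

lemma periodic_add_int:
  fixes f :: "real \<Rightarrow> 'a"
  assumes per: "\<And>x. f (x + P) = f x"
  shows "f (x + of_int k * P) = f x"
proof (induction k rule: int_induct[where k = 0])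
  case (step1 i)
  have "f (x + of_int (i + 1) * P) = f ((x + of_int i * P) + P)"
    by (simp add: algebra_simps)
  with step1 per show ?case by metis
next
  case (step2 i)
  have "f (x + of_int (i - 1) * P) = f ((x + of_int (i - 1) * P) + P)"
    by (rule per[symmetric])
  also have "(x + of_int (i - 1) * P) + P = x + of_int i * P"
    by (simp add: algebra_simps)
  finally show ?case using step2 by simp
qed simp

lemma nn_integral_period:
  fixes f :: "real \<Rightarrow> ennreal"
  assumes [measurable]: "f \<in> borel_measurable borel"
    and P: "P > 0" and per: "\<And>x. f (x + P) = f x"
  shows "(\<integral>\<^sup>+x\<in>{a..<a + P}. f x \<partial>lborel) = (\<integral>\<^sup>+x\<in>{0..<P}. f x \<partial>lborel)"
proof -
  define k where "k = \<lfloor>a / P\<rfloor>"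
  define b where "b = a - of_int k * P"
  have b: "0 \<le> b" "b \<le> P"
  proof -
    have "of_int k \<le> a / P" "a / P < of_int k + 1"
      unfolding k_def by linarith+
    then show "0 \<le> b" "b \<le> P"
      using P by (simp_all add: b_def field_simps)
  qed
  have "(\<integral>\<^sup>+x\<in>{a..<a + P}. f x \<partial>lborel) =
      (\<integral>\<^sup>+x\<in>{b + of_int k * P..<(b + P) + of_int k * P}. f x \<partial>lborel)"
    by (simp add: b_def)
  also have "\<dots> = (\<integral>\<^sup>+x\<in>{b..<b + P}. f x \<partial>lborel)"
    by (subst nn_integral_Ico_translate) (simp_all add: periodic_add_int[of f P, OF per])
  also have "\<dots> = (\<integral>\<^sup>+x\<in>{b..<P}. f x \<partial>lborel) + (\<integral>\<^sup>+x\<in>{0 + P..<b + P}. f x \<partial>lborel)"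
    using b by (subst nn_integral_Ico_split[where b = P]) auto
  also have "(\<integral>\<^sup>+x\<in>{0 + P..<b + P}. f x \<partial>lborel) = (\<integral>\<^sup>+x\<in>{0..<b}. f x \<partial>lborel)"
    by (subst nn_integral_Ico_translate) (simp_all add: per)
  finally show ?thesis
    using b by (subst (2) nn_integral_Ico_split[where b = b]) (auto simp: add.commute)
qed

lemma nn_integral_periods:
  fixes f :: "real \<Rightarrow> ennreal"
  assumes [measurable]: "f \<in> borel_measurable borel"
    and P: "P > 0" and per: "\<And>x. f (x + P) = f x"
  shows "(\<integral>\<^sup>+x\<in>{a..<a + of_nat M * P}. f x \<partial>lborel) = of_nat M * (\<integral>\<^sup>+x\<in>{0..<P}. f x \<partial>lborel)"
proof (induction M)
  case (Suc M)
  have "(\<integral>\<^sup>+x\<in>{a..<a + of_nat (Suc M) * P}. f x \<partial>lborel) =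
      (\<integral>\<^sup>+x\<in>{a..<a + of_nat M * P}. f x \<partial>lborel) +
      (\<integral>\<^sup>+x\<in>{a + of_nat M * P..<(a + of_nat M * P) + P}. f x \<partial>lborel)"
    using P by (subst nn_integral_Ico_split[where b = "a + of_nat M * P"]) (auto simp: algebra_simps)
  then show ?case
    by (simp only: Suc nn_integral_period[OF assms]) (simp add: algebra_simps)
qed simp

text \<open>The substitution u = c + h x carries the interval onto exactly M periods, so neither a
  nor c affects the value; 1 / h is the Jacobian.\<close>

lemma nn_integral_affine_periods:
  fixes f :: "real \<Rightarrow> ennreal"
  assumes [measurable]: "f \<in> borel_measurable borel"
    and P: "P > 0" and per: "\<And>x. f (x + P) = f x"
    and h: "h > 0" and l: "h * l = of_nat M * P"
  shows "(\<integral>\<^sup>+x\<in>{a..<a + l}. f (c + h * x) \<partial>lborel) =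
    ennreal (of_nat M / h) * (\<integral>\<^sup>+x\<in>{0..<P}. f x \<partial>lborel)"
proof -
  define b where "b = c + h * a"
  have ind: "indicator {b..<b + of_nat M * P} (c + h * x) = (indicator {a..<a + l} x :: ennreal)" for x
    using h unfolding b_def l[symmetric] by (auto simp: indicator_def simp flip: distrib_left)
  have "of_nat M * (\<integral>\<^sup>+x\<in>{0..<P}. f x \<partial>lborel) = (\<integral>\<^sup>+x\<in>{b..<b + of_nat M * P}. f x \<partial>lborel)"
    by (rule nn_integral_periods[OF assms(1-3), symmetric])
  also have "\<dots> = ennreal h * (\<integral>\<^sup>+x\<in>{a..<a + l}. f (c + h * x) \<partial>lborel)"
    using h by (subst nn_integral_real_affine[where c = h and t = c]) (simp_all add: ind)
  finally have "ennreal (1 / h) * (of_nat M * (\<integral>\<^sup>+x\<in>{0..<P}. f x \<partial>lborel)) =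
      ennreal (1 / h) * ennreal h * (\<integral>\<^sup>+x\<in>{a..<a + l}. f (c + h * x) \<partial>lborel)"
    by (simp add: mult.assoc)
  also have "ennreal (1 / h) * ennreal h = 1"
    using h by (simp flip: ennreal_mult)
  finally show ?thesis
    using h by (simp add: ennreal_mult' ennreal_of_nat_eq_real_of_nat divide_inverse mult_ac)
qed

subsection \<open>Coprime approximation in one coordinate\<close>

text \<open>The argument q enters only through coprimality, so q = 1 gives the plain set of reals
  within r of an integer.\<close>

definition cop_nbhd :: "nat \<Rightarrow> real \<Rightarrow> real set" where
  "cop_nbhd q r = {u. \<exists>p::int. coprime p (int q) \<and> \<bar>u + of_int p\<bar> \<le> r}"

lemma cop_nbhd_eq_Union:
  "cop_nbhd q r = (\<Union>p\<in>{p. coprime p (int q)}. {- of_int p - r..- of_int p + r})"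
proof -
  have "\<bar>u + of_int p\<bar> \<le> r \<longleftrightarrow> u \<in> {- of_int p - r..- of_int p + r}" for u and p :: int
    by (auto simp: abs_le_iff)
  then show ?thesis
    by (auto simp: cop_nbhd_def)
qed

lemma cop_nbhd_borel [measurable]: "cop_nbhd q r \<in> sets borel"
  unfolding cop_nbhd_eq_Union by auto

lemma cop_nbhd_subset: "cop_nbhd q r \<subseteq> cop_nbhd 1 r"
  by (auto simp: cop_nbhd_def)

lemma cop_nbhd_period: "u + of_nat q \<in> cop_nbhd q r \<longleftrightarrow> u \<in> cop_nbhd q r"
proof
  assume "u + of_nat q \<in> cop_nbhd q r"
  then obtain p where p: "coprime p (int q)" "\<bar>u + of_int (p + int q)\<bar> \<le> r"
    by (auto simp: cop_nbhd_def algebra_simps)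
  moreover have "coprime (p + int q) (int q)"
    using p(1) by (metis gcd_add1 coprime_iff_gcd_eq_1)
  ultimately show "u \<in> cop_nbhd q r"
    by (auto simp: cop_nbhd_def)
next
  assume "u \<in> cop_nbhd q r"
  then obtain p where p: "coprime p (int q)" "\<bar>u + of_int p\<bar> \<le> r"
    by (auto simp: cop_nbhd_def)
  have "coprime (p - int q) (int q)"
    using p(1) by (metis gcd_add1 coprime_iff_gcd_eq_1 diff_add_cancel)
  then show "u + of_nat q \<in> cop_nbhd q r"
    using p(2) unfolding cop_nbhd_def by (intro CollectI exI[of _ "p - int q"]) (simp add: algebra_simps)
qed

lemma cop_nbhd_uminus: "- u \<in> cop_nbhd q r \<longleftrightarrow> u \<in> cop_nbhd q r"
proof -
  have "- u \<in> cop_nbhd q r" if "u \<in> cop_nbhd q r" for u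
  proof -
    from that obtain p :: int where "coprime p (int q)" "\<bar>u + of_int p\<bar> \<le> r"
      by (auto simp: cop_nbhd_def)
    then have "coprime (- p) (int q)" "\<bar>- u + of_int (- p)\<bar> \<le> r" by simp_all
    then show ?thesis unfolding cop_nbhd_def by blast
  qed
  from this[of u] this[of "- u"] show ?thesis by auto
qed

lemma set_nn_integral_indicator:
  assumes "A \<in> sets M" "B \<in> sets M"
  shows "(\<integral>\<^sup>+u\<in>B. indicator A u \<partial>M) = emeasure M (A \<inter> B)"
  using assms by (simp flip: indicator_inter_arith)

lemma nn_integral_cop_nbhd_ge:
  fixes r :: real
  assumes r: "0 \<le> r" "r < 1/2" and q: "q > 0"
  shows "ennreal (2 * r * totient q) \<le> (\<integral>\<^sup>+u\<in>{0..<real q}. indicator (cop_nbhd q r) u \<partial>lborel)"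
proof -
  let ?I = "\<lambda>p. {real p - r..real p + r}"
  \<comment> \<open>The pieces of \<open>cop_nbhd\<close> are centred at -p, so an interval about a
    totative is matched with them by reflection.\<close>
  have inv: "- u \<in> cop_nbhd q r" if "u \<in> ?I p" "p \<in> totatives q" for u p
    using that by (auto simp: cop_nbhd_def in_totatives_iff abs_le_iff intro!: exI[of _ "int p"])
  \<comment> \<open>Starting the window at 1/2 leaves room for the whole interval about every p with
    1 \<le> p \<le> q, including p = q when q = 1.\<close>
  have sub: "(\<Union>p\<in>totatives q. ?I p) \<subseteq> cop_nbhd q r \<inter> {1/2..<1/2 + real q}"
  proof safe
    fix u p assume p: "p \<in> totatives q" and u: "u \<in> ?I p"
    show "u \<in> cop_nbhd q r" using inv[OF u p] by (simp add: cop_nbhd_uminus)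
    have "1 \<le> p" "p \<le> q" using p by (auto simp: in_totatives_iff)
    then have "1 \<le> real p" "real p \<le> real q" by auto
    then show "u \<in> {1/2..<1/2 + real q}" using u r by auto
  qed
  have "disjoint_family_on ?I (totatives q)"
  unfolding disjoint_family_on_def
  proof (intro ballI impI)
    fix a b :: nat assume "a \<noteq> b"
    then have "\<bar>real a - real b\<bar> \<ge> 1" by linarith
    then show "?I a \<inter> ?I b = {}" using r by auto
  qed
  then have "emeasure lborel (\<Union>p\<in>totatives q. ?I p) = (\<Sum>p\<in>totatives q. emeasure lborel (?I p))"
    by (intro sum_emeasure[symmetric]) auto
  also have "\<dots> = (\<Sum>p\<in>totatives q. ennreal (2 * r))"
    using r by (intro sum.cong) (auto simp: algebra_simps)
  also have "\<dots> = ennreal (2 * r * totient q)"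
    using r by (simp add: totient_def ennreal_mult'' ennreal_of_nat_eq_real_of_nat mult.commute)
  finally have "ennreal (2 * r * totient q) = emeasure lborel (\<Union>p\<in>totatives q. ?I p)" ..
  also have "\<dots> \<le> emeasure lborel (cop_nbhd q r \<inter> {1/2..<1/2 + real q})"
    using sub by (intro emeasure_mono) auto
  also have "\<dots> = (\<integral>\<^sup>+u\<in>{1/2..<1/2 + real q}. indicator (cop_nbhd q r) u \<partial>lborel)"
    by (simp add: set_nn_integral_indicator)
  also have "\<dots> = (\<integral>\<^sup>+u\<in>{0..<real q}. indicator (cop_nbhd q r) u \<partial>lborel)"
    using q by (intro nn_integral_period) (auto simp: indicator_def cop_nbhd_period)
  finally show ?thesis .
qed

lemma nn_integral_cop_nbhd_1_le:
  fixes r :: real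
  assumes r: "0 \<le> r" "r < 1/2"
  shows "(\<integral>\<^sup>+u\<in>{0..<1}. indicator (cop_nbhd 1 r) u \<partial>lborel) \<le> ennreal (2 * r)"
proof -
  have sub: "cop_nbhd 1 r \<inter> {-1/2..<-1/2 + 1} \<subseteq> {- r..r}"
  proof
    fix u assume u: "u \<in> cop_nbhd 1 r \<inter> {-1/2..<-1/2 + 1}"
    then obtain p :: int where p: "\<bar>u + of_int p\<bar> \<le> r" by (auto simp: cop_nbhd_def)
    have "p = 0"
    proof (rule ccontr)
      assume "p \<noteq> 0"
      then have "p \<ge> 1 \<or> p \<le> -1" by linarith
      then have "real_of_int p \<ge> 1 \<or> real_of_int p \<le> -1" by linarith
      then show False using p u r by auto
    qed
    then show "u \<in> {- r..r}" using p by auto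
  qed
  have per: "u + 1 \<in> cop_nbhd 1 r \<longleftrightarrow> u \<in> cop_nbhd 1 r" for u
    using cop_nbhd_period[of u 1 r] by simp
  have "(\<integral>\<^sup>+u\<in>{0..<1}. indicator (cop_nbhd 1 r) u \<partial>lborel) =
      (\<integral>\<^sup>+u\<in>{-1/2..<-1/2 + 1}. indicator (cop_nbhd 1 r) u \<partial>lborel)"
    by (intro nn_integral_period[symmetric]) (auto simp: indicator_def per simp del: One_nat_def)
  also have "\<dots> = emeasure lborel (cop_nbhd 1 r \<inter> {-1/2..<-1/2 + 1})"
    by (simp add: set_nn_integral_indicator)
  also have "\<dots> \<le> emeasure lborel {- r..r}"
    using sub by (intro emeasure_mono) auto
  finally show ?thesis
    using r by simp
qed

text \<open>Multiplication by N^2 m stretches a side 1/N to length N m, exactly one period of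
  \<open>cop_nbhd (N * m) r\<close>. Hence the x-integral has the right size for each fixed y, and
  integrating over y only multiplies by 1/N.\<close>

lemma nn_integral_cop_nbhd_block_ge:
  fixes N m :: nat and r :: real
  assumes N: "N > 0" and m: "m > 0" and r: "0 \<le> r" "r < 1/2"
  shows "ennreal (2 * r * (totient (N * m) / (N * m)) / (N * N)) \<le>
    (\<integral>\<^sup>+y\<in>{c..c + 1/N}. (\<integral>\<^sup>+x\<in>{a..a + 1/N}. indicator (cop_nbhd (N * m) r) (N\<^sup>2 * m * x - y) \<partial>lborel) \<partial>lborel)"
proof -
  let ?P = "N * m" and ?h = "real (N\<^sup>2 * m)"
  have inner: "ennreal (2 * r * (totient ?P / ?P) / N) \<le>
      (\<integral>\<^sup>+x\<in>{a..a + 1/N}. indicator (cop_nbhd ?P r) (?h * x - y) \<partial>lborel)" for y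
  proof -
    have "ennreal (2 * r * (totient ?P / ?P) / N) = ennreal (1 / ?h) * ennreal (2 * r * totient ?P)"
      using r N m by (subst ennreal_mult[symmetric]) (auto simp: power2_eq_square field_simps)
    also have "\<dots> \<le> ennreal (of_nat 1 / ?h) * (\<integral>\<^sup>+u\<in>{0..<real ?P}. indicator (cop_nbhd ?P r) u \<partial>lborel)"
      using nn_integral_cop_nbhd_ge[OF r, of ?P] N m by (intro mult_mono) auto
    also have "\<dots> = (\<integral>\<^sup>+x\<in>{a..<a + 1/N}. indicator (cop_nbhd ?P r) (- y + ?h * x) \<partial>lborel)"
      using N m by (intro nn_integral_affine_periods[symmetric])
        (auto simp: indicator_def cop_nbhd_period[of _ ?P, simplified] power2_eq_square)
    finally show ?thesis
      by (simp add: nn_integral_Icc_eq_Ico)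
  qed
  have "ennreal (2 * r * (totient ?P / ?P) / (N * N)) = (\<integral>\<^sup>+y\<in>{c..c + 1/N}. ennreal (2 * r * (totient ?P / ?P) / N) \<partial>lborel)"
    using r N by (subst nn_integral_cmult_indicator) (auto simp flip: ennreal_mult)
  also have "\<dots> \<le> (\<integral>\<^sup>+y\<in>{c..c + 1/N}. (\<integral>\<^sup>+x\<in>{a..a + 1/N}. indicator (cop_nbhd ?P r) (?h * x - y) \<partial>lborel) \<partial>lborel)"
    by (intro nn_integral_mono mult_right_mono inner) auto
  finally show ?thesis by simp
qed

section \<open>Pairwise independence on the torus and on small squares\<close>

lemma set_nn_integral_swap:
  fixes F :: "real \<Rightarrow> real \<Rightarrow> ennreal"
  assumes F: "(\<lambda>(x, y). F x y) \<in> borel_measurable (borel \<Otimes>\<^sub>M borel)"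
    and [measurable]: "A \<in> sets borel" "B \<in> sets borel"
  shows "(\<integral>\<^sup>+y\<in>B. (\<integral>\<^sup>+x\<in>A. F x y \<partial>lborel) \<partial>lborel) = (\<integral>\<^sup>+x\<in>A. (\<integral>\<^sup>+y\<in>B. F x y \<partial>lborel) \<partial>lborel)"
proof -
  have [measurable]: "case_prod F \<in> borel_measurable (borel \<Otimes>\<^sub>M borel)"
    using F by simp
  have "(\<integral>\<^sup>+y\<in>B. (\<integral>\<^sup>+x\<in>A. F x y \<partial>lborel) \<partial>lborel) =
      (\<integral>\<^sup>+y. (\<integral>\<^sup>+x. F x y * indicator A x * indicator B y \<partial>lborel) \<partial>lborel)"
    by (subst nn_integral_multc) (auto intro!: nn_integral_cong)
  also have "\<dots> = (\<integral>\<^sup>+x. (\<integral>\<^sup>+y. F x y * indicator A x * indicator B y \<partial>lborel) \<partial>lborel)"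
    by (rule lborel_pair.Fubini') measurable
  also have "\<dots> = (\<integral>\<^sup>+x. (\<integral>\<^sup>+y. F x y * indicator B y * indicator A x \<partial>lborel) \<partial>lborel)"
    by (simp add: mult_ac)
  also have "\<dots> = (\<integral>\<^sup>+x\<in>A. (\<integral>\<^sup>+y\<in>B. F x y \<partial>lborel) \<partial>lborel)"
    by (subst nn_integral_multc) (auto intro!: nn_integral_cong)
  finally show ?thesis .
qed

lemma periodic_add_of_int:
  fixes f :: "real \<Rightarrow> 'a"
  assumes "\<And>x. f (x + 1) = f x"
  shows "f (x + of_int k) = f x"
  using periodic_add_int[of f 1, OF assms] by simp

text \<open>On the torus, \<open>(x, y) \<mapsto> (q x - y, q' x - y)\<close> preserves Lebesgue measure when \<open>q \<noteq> q'\<close>.\<close>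
lemma nn_integral_torus_pair:
  fixes f g :: "real \<Rightarrow> ennreal" and q q' :: nat
  assumes [measurable]: "f \<in> borel_measurable borel" "g \<in> borel_measurable borel"
    and f: "\<And>x. f (x + 1) = f x" and g: "\<And>x. g (x + 1) = g x"
    and even: "\<And>x. f (- x) = f x" and q: "q < q'"
  shows "(\<integral>\<^sup>+y\<in>{0..<1}. (\<integral>\<^sup>+x\<in>{0..<1}. f (real q * x - y) * g (real q' * x - y) \<partial>lborel) \<partial>lborel) =
    (\<integral>\<^sup>+x\<in>{0..<1}. f x \<partial>lborel) * (\<integral>\<^sup>+x\<in>{0..<1}. g x \<partial>lborel)"
proof -
  define h where "h = real q' - real q"
  have h: "h > 0" "h = of_nat (q' - q)" using q by (auto simp: h_def of_nat_diff)
  \<comment> \<open>Shifting y by q x, allowed by period 1 in y, removes x from the first factor;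
    evenness turns f (- y) into f y.\<close>
  have shear: "(\<integral>\<^sup>+y\<in>{0..<1}. f (real q * x - y) * g (real q' * x - y) \<partial>lborel) =
      (\<integral>\<^sup>+y\<in>{0..<1}. f y * g (h * x - y) \<partial>lborel)" for x
  proof -
    define K where "K y = f (real q * x - y) * g (real q' * x - y)" for y
    have [measurable]: "K \<in> borel_measurable borel"
      unfolding K_def by measurable
    have shifted: "K (y + q * x) = f y * g (h * x - y)" for y
      using even[of y] by (simp add: K_def h_def algebra_simps)
    have K: "K (y + 1) = K y" for y
      using f[of "q * x - (y + 1)"] g[of "q' * x - (y + 1)"] by (simp add: K_def algebra_simps)
    have "(\<integral>\<^sup>+y\<in>{0..<1}. K y \<partial>lborel) = (\<integral>\<^sup>+y\<in>{0 + q * x..<1 + q * x}. K y \<partial>lborel)"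
      using nn_integral_period[of K 1 "q * x"] K by (simp add: add.commute)
    also have "\<dots> = (\<integral>\<^sup>+y\<in>{0..<1}. K (y + q * x) \<partial>lborel)"
      by (rule nn_integral_Ico_translate) measurable
    finally show ?thesis
      by (simp only: shifted) (simp add: K_def)
  qed
  \<comment> \<open>For fixed y the argument runs through q' - q \<ge> 1 full periods of g, so the
    x-integral no longer depends on y.\<close>
  have affine: "(\<integral>\<^sup>+x\<in>{0..<1}. g (h * x - y) \<partial>lborel) = (\<integral>\<^sup>+x\<in>{0..<1}. g x \<partial>lborel)" for y
    using nn_integral_affine_periods[where f = g and P = 1 and h = h and l = 1 and M = "q' - q" and a = 0 and c = "- y"] g h
    by (simp del: of_nat_diff)
  have "(\<integral>\<^sup>+y\<in>{0..<1}. (\<integral>\<^sup>+x\<in>{0..<1}. f (real q * x - y) * g (real q' * x - y) \<partial>lborel) \<partial>lborel) =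
      (\<integral>\<^sup>+x\<in>{0..<1}. (\<integral>\<^sup>+y\<in>{0..<1}. f (real q * x - y) * g (real q' * x - y) \<partial>lborel) \<partial>lborel)"
    by (rule set_nn_integral_swap) measurable
  also have "\<dots> = (\<integral>\<^sup>+x\<in>{0..<1}. (\<integral>\<^sup>+y\<in>{0..<1}. f y * g (h * x - y) \<partial>lborel) \<partial>lborel)"
    by (simp only: shear)
  also have "\<dots> = (\<integral>\<^sup>+y\<in>{0..<1}. (\<integral>\<^sup>+x\<in>{0..<1}. f y * g (h * x - y) \<partial>lborel) \<partial>lborel)"
    by (rule set_nn_integral_swap[symmetric]) measurable
  also have "\<dots> = (\<integral>\<^sup>+y\<in>{0..<1}. f y * (\<integral>\<^sup>+x\<in>{0..<1}. g x \<partial>lborel) \<partial>lborel)"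
    by (simp add: nn_integral_cmult mult.assoc affine)
  also have "\<dots> = (\<integral>\<^sup>+y\<in>{0..<1}. f y \<partial>lborel) * (\<integral>\<^sup>+x\<in>{0..<1}. g x \<partial>lborel)"
    by (subst nn_integral_multc[symmetric]) (auto simp: mult_ac)
  finally show ?thesis .
qed

text \<open>The translations by \<open>(1/N, 0)\<close> and \<open>(1/N\<^sup>3, 1/N)\<close> preserve the integrand.\<close>
lemma nn_integral_block_pair:
  fixes f g :: "real \<Rightarrow> ennreal" and N j j' :: nat
  assumes [measurable]: "f \<in> borel_measurable borel" "g \<in> borel_measurable borel"
    and f: "\<And>x. f (x + 1) = f x" and g: "\<And>x. g (x + 1) = g x"
    and even: "\<And>x. f (- x) = f x" and j: "j < j'" and N: "N > 0"
    and q: "q = N\<^sup>2 * (1 + N * j)" "q' = N\<^sup>2 * (1 + N * j')"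
  shows "(\<integral>\<^sup>+y\<in>{c..c + 1/N}. (\<integral>\<^sup>+x\<in>{a..a + 1/N}. f (real q * x - y) * g (real q' * x - y) \<partial>lborel) \<partial>lborel) =
    ennreal (1 / (N * N)) * ((\<integral>\<^sup>+x\<in>{0..<1}. f x \<partial>lborel) * (\<integral>\<^sup>+x\<in>{0..<1}. g x \<partial>lborel))"
proof -
  define F where "F x y = f (real q * x - y) * g (real q' * x - y)" for x y
  have [measurable]: "(\<lambda>(x, y). F x y) \<in> borel_measurable (borel \<Otimes>\<^sub>M borel)"
    "F x \<in> borel_measurable borel" "(\<lambda>x. F x y) \<in> borel_measurable borel" for x y
    unfolding F_def by measurable
  have shift: "F (x + s) (y + t) = F x y" if "real q * s - t = of_int k" "real q' * s - t = of_int l" for x y s t k l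
  proof -
    have "real q * (x + s) - (y + t) = real q * x - y + of_int k"
      "real q' * (x + s) - (y + t) = real q' * x - y + of_int l"
      using that by (simp_all add: algebra_simps)
    then show ?thesis
      unfolding F_def by (simp only: periodic_add_of_int[of f, OF f] periodic_add_of_int[of g, OF g])
  qed
  have x1: "F (x + 1) y = F x y" for x y
    using shift[of 1 0 q q'] by simp
  have xN: "F (x + 1/N) y = F x y" for x y
    using shift[of "1/N" 0 "N * (1 + N * j)" "N * (1 + N * j')"] N
    by (simp add: q power2_eq_square add_divide_distrib)
  \<comment> \<open>Since q = N^2 (1 + N j), one has q / N^3 = 1 / N + j, and the shift of y cancels
    the summand 1 / N.\<close>
  have yN: "F (x + 1 / real N ^ 3) (y + 1/N) = F x y" for x y
    using shift[of "1 / real N ^ 3" "1/N" j j'] N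
    by (simp add: q power2_eq_square power3_eq_cube field_simps)
  define \<Phi> where "\<Phi> y = (\<integral>\<^sup>+x\<in>{0..<1}. F x y \<partial>lborel)" for y
  have [measurable]: "\<Phi> \<in> borel_measurable borel"
    unfolding \<Phi>_def by measurable
  have sub: "(\<integral>\<^sup>+x\<in>{a..a + 1/N}. F x y \<partial>lborel) = ennreal (1/N) * \<Phi> y" for y
  proof -
    have "\<Phi> y = of_nat N * (\<integral>\<^sup>+x\<in>{0..<1/N}. F x y \<partial>lborel)"
      using nn_integral_periods[of "\<lambda>x. F x y" "1/N" 0 N] N by (simp add: xN \<Phi>_def)
    also have "(\<integral>\<^sup>+x\<in>{0..<1/N}. F x y \<partial>lborel) = (\<integral>\<^sup>+x\<in>{a..a + 1/N}. F x y \<partial>lborel)"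
      using nn_integral_period[of "\<lambda>x. F x y" "1/N" a] N by (simp add: xN nn_integral_Icc_eq_Ico)
    finally have "ennreal (1/N) * \<Phi> y = ennreal (1/N) * ennreal N * (\<integral>\<^sup>+x\<in>{a..a + 1/N}. F x y \<partial>lborel)"
      by (simp add: mult.assoc ennreal_of_nat_eq_real_of_nat)
    also have "ennreal (1/N) * ennreal N = 1"
      using N by (simp flip: ennreal_mult)
    finally show ?thesis by simp
  qed
  \<comment> \<open>Moving y by 1 / N costs a shift of x by 1 / N^3, which is harmless because
    \<open>\<Phi>\<close> integrates over a full period in x.\<close>
  have \<Phi>: "\<Phi> (y + 1/N) = \<Phi> y" for y
  proof -
    have "\<Phi> (y + 1/N) = (\<integral>\<^sup>+x\<in>{1 / real N ^ 3..<1 / real N ^ 3 + 1}. F x (y + 1/N) \<partial>lborel)"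
      unfolding \<Phi>_def by (rule nn_integral_period[symmetric]) (auto simp: x1)
    also have "\<dots> = (\<integral>\<^sup>+x\<in>{0..<1}. F (x + 1 / real N ^ 3) (y + 1/N) \<partial>lborel)"
      using nn_integral_Ico_translate[of "\<lambda>x. F x (y + 1/N)" 0 "1 / real N ^ 3" 1] by (simp add: add.commute)
    finally show ?thesis
      by (simp add: yN \<Phi>_def)
  qed
  have "(\<integral>\<^sup>+y\<in>{c..c + 1/N}. \<Phi> y \<partial>lborel) = (\<integral>\<^sup>+y\<in>{0..<1/N}. \<Phi> y \<partial>lborel)"
    using nn_integral_period[of \<Phi> "1/N" c] N \<Phi> by (simp add: nn_integral_Icc_eq_Ico)
  moreover have "(\<integral>\<^sup>+y\<in>{0..<1}. \<Phi> y \<partial>lborel) = of_nat N * (\<integral>\<^sup>+y\<in>{0..<1/N}. \<Phi> y \<partial>lborel)"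
    using nn_integral_periods[of \<Phi> "1/N" 0 N] N \<Phi> by simp
  ultimately have "ennreal (1/N) * (\<integral>\<^sup>+y\<in>{0..<1}. \<Phi> y \<partial>lborel) =
      ennreal (1/N) * ennreal N * (\<integral>\<^sup>+y\<in>{c..c + 1/N}. \<Phi> y \<partial>lborel)"
    by (simp add: mult.assoc ennreal_of_nat_eq_real_of_nat)
  also have "ennreal (1/N) * ennreal N = 1"
    using N by (simp flip: ennreal_mult)
  finally have suby: "(\<integral>\<^sup>+y\<in>{c..c + 1/N}. \<Phi> y \<partial>lborel) = ennreal (1/N) * (\<integral>\<^sup>+y\<in>{0..<1}. \<Phi> y \<partial>lborel)"
    by simp
  have "q < q'" using j N q by simp
  then have torus: "(\<integral>\<^sup>+y\<in>{0..<1}. \<Phi> y \<partial>lborel) =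
      (\<integral>\<^sup>+x\<in>{0..<1}. f x \<partial>lborel) * (\<integral>\<^sup>+x\<in>{0..<1}. g x \<partial>lborel)"
    unfolding \<Phi>_def F_def by (intro nn_integral_torus_pair f g even) auto
  have "(\<integral>\<^sup>+y\<in>{c..c + 1/N}. (\<integral>\<^sup>+x\<in>{a..a + 1/N}. F x y \<partial>lborel) \<partial>lborel) =
      ennreal (1/N) * (\<integral>\<^sup>+y\<in>{c..c + 1/N}. \<Phi> y \<partial>lborel)"
    by (subst nn_integral_cmult[symmetric]) (auto simp: sub mult.assoc)
  also have "\<dots> = ennreal (1/N) * ennreal (1/N) * (\<integral>\<^sup>+y\<in>{0..<1}. \<Phi> y \<partial>lborel)"
    by (simp add: suby mult.assoc)
  also have "ennreal (1/N) * ennreal (1/N) = ennreal (1 / (N * N))"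
    by (simp flip: ennreal_mult)
  finally show ?thesis
    by (simp add: torus F_def)
qed

text \<open>The independence identity applies to functions of period 1, which modulus 1 provides;
  neighbourhoods with coprimality lie inside these by \<open>cop_nbhd_subset\<close>, so their
  intersections obey the same bound.\<close>

lemma nn_integral_cop_nbhd_pair_le:
  fixes r r' :: real and N j j' :: nat
  assumes r: "0 \<le> r" "r < 1/2" and r': "0 \<le> r'" "r' < 1/2" and j: "j < j'" and N: "N > 0"
    and q: "q = N\<^sup>2 * (1 + N * j)" "q' = N\<^sup>2 * (1 + N * j')"
  shows "(\<integral>\<^sup>+y\<in>{c..c + 1/N}. (\<integral>\<^sup>+x\<in>{a..a + 1/N}.
      indicator (cop_nbhd 1 r) (real q * x - y) * indicator (cop_nbhd 1 r') (real q' * x - y) \<partial>lborel) \<partial>lborel) \<le>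
    ennreal (2 * r * (2 * r') / (N * N))"
proof -
  have per: "indicator (cop_nbhd 1 s) (x + 1) = (indicator (cop_nbhd 1 s) x :: ennreal)" for x s
    using cop_nbhd_period[of x 1 s] by (simp add: indicator_def)
  have even: "indicator (cop_nbhd 1 s) (- x) = (indicator (cop_nbhd 1 s) x :: ennreal)" for x s
    by (simp add: indicator_def cop_nbhd_uminus)
  have "ennreal (1 / (N * N)) * ((\<integral>\<^sup>+x\<in>{0..<1}. indicator (cop_nbhd 1 r) x \<partial>lborel) *
      (\<integral>\<^sup>+x\<in>{0..<1}. indicator (cop_nbhd 1 r') x \<partial>lborel)) \<le>
      ennreal (1 / (N * N)) * (ennreal (2 * r) * ennreal (2 * r'))"
    using nn_integral_cop_nbhd_1_le r r' by (intro mult_mono) auto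
  also have "\<dots> = ennreal (2 * r * (2 * r') / (N * N))"
    using r r' by (simp flip: ennreal_mult)
  finally show ?thesis
    by (subst nn_integral_block_pair[OF _ _ _ _ _ j N q]) (simp_all add: per even del: One_nat_def)
qed

subsection \<open>The totient along an arithmetic progression\<close>

text \<open>Since (2 i + 1)^2 > 4 i (i + 1), the terms are dominated by the telescoping differences
  (1 / i - 1 / (i + 1)) / 4.\<close>

lemma sum_inverse_odd_squares_le: "(\<Sum>i=1..M. 1 / (2 * real i + 1)\<^sup>2) \<le> 1/4"
proof -
  have "(\<Sum>i=1..M. 1 / (2 * real i + 1)\<^sup>2) \<le> 1/4 - 1 / (4 * (real M + 1))"
  proof (induction M)
    case (Suc M)
    have "1 / (2 * real (Suc M) + 1)\<^sup>2 \<le> 1 / (4 * (real M + 1)) - 1 / (4 * (real (Suc M) + 1))"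
      by (simp add: divide_simps power2_eq_square) (simp add: algebra_simps)
    with Suc show ?case by simp
  qed simp
  also have "\<dots> \<le> 1/4" by simp
  finally show ?thesis .
qed

text \<open>One solution j already forces gcd(d, N) = 1, because a common divisor divides both 1 + N
  j and N j. Solutions are then congruent modulo d, and each block of d consecutive integers holds
  at most one.\<close>

lemma card_dvd_progression_le:
  fixes d N X :: nat
  assumes d: "d > 0"
  shows "real (card {j\<in>{..<X}. d dvd 1 + N * j}) \<le> X / d + 1"
proof -
  let ?A = "{j\<in>{..<X}. d dvd 1 + N * j}"
  have "inj_on (\<lambda>j. j div d) ?A"
  proof (rule inj_onI)
    fix i j assume ij: "i \<in> ?A" "j \<in> ?A" "i div d = j div d"
    have "coprime d N"
    proof (rule coprimeI)
      fix c assume c: "c dvd d" "c dvd N"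
      then have "c dvd 1 + N * i" "c dvd N * i"
        using ij(1) by (auto intro: dvd_trans)
      then show "is_unit c"
        using dvd_add_left_iff by blast
    qed
    moreover have "[1 + N * i = 1 + N * j] (mod d)"
      using ij by (auto simp: cong_def dvd_eq_mod_eq_0)
    ultimately have "[i = j] (mod d)"
      by (metis cong_add_lcancel_nat cong_mult_lcancel_nat coprime_commute)
    with ij(3) show "i = j"
      by (metis cong_def div_mult_mod_eq)
  qed
  then have "card ?A = card ((\<lambda>j. j div d) ` ?A)"
    by (simp add: card_image)
  also have "(\<lambda>j. j div d) ` ?A \<subseteq> {..X div d}"
    by (auto intro: div_le_mono)
  then have "card ((\<lambda>j. j div d) ` ?A) \<le> X div d + 1"
    using card_mono[OF finite_atMost] by fastforce
  finally have "real (card ?A) \<le> real (X div d) + 1" by linarith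
  also have "real (X div d) \<le> X / d"
    by (rule of_nat_div_le_of_nat)
  finally show ?thesis by simp
qed

text \<open>For m > 0 this is sigma(m) / m - 1. Being a sum of positive terms over divisors, it is
  easy to average over a progression, and a small value keeps the totient large.\<close>

definition inv_divisor_sum :: "nat \<Rightarrow> real" where
  "inv_divisor_sum m = (\<Sum>d | d dvd m \<and> (1::nat) < d. 1 / real d)"

text \<open>Gauss's identity writes m as the sum of \<phi>(d) over d dividing m. Each proper divisor
  d contributes at most d, and exchanging d with m / d turns the sum of proper divisors into m times
  \<open>inv_divisor_sum m\<close>.\<close>

lemma totient_ge_inv_divisor_sum:
  assumes m: "m > 0"
  shows "real m * (1 - inv_divisor_sum m) \<le> totient m"
proof -
  have fin: "finite {d. d dvd m}" using m by simp
  have "m = (\<Sum>d | d dvd m. totient d)" by (rule totient_divisor_sum[symmetric])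
  also have "{d. d dvd m} = insert m {d. d dvd m \<and> d < m}"
    using m by (auto dest: dvd_imp_le)
  also have "(\<Sum>d\<in>insert m {d. d dvd m \<and> d < m}. totient d) = totient m + (\<Sum>d | d dvd m \<and> d < m. totient d)"
    using fin by (subst sum.insert) auto
  also have "(\<Sum>d | d dvd m \<and> d < m. totient d) \<le> (\<Sum>d | d dvd m \<and> d < m. d)"
    by (intro sum_mono totient_le)
  finally have "real m \<le> totient m + (\<Sum>d | d dvd m \<and> d < m. real d)"
    by (simp flip: of_nat_sum of_nat_add)
  also have "(\<Sum>d | d dvd m \<and> d < m. real d) = (\<Sum>d | d dvd m \<and> (1::nat) < d. real m / real d)"
    using m by (intro sum.reindex_bij_witness[of _ "\<lambda>d. m div d" "\<lambda>d. m div d"])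
      (auto elim!: dvdE simp: real_of_nat_div)
  also have "\<dots> = m * inv_divisor_sum m"
    by (simp add: inv_divisor_sum_def sum_distrib_left)
  finally show ?thesis by (simp add: algebra_simps)
qed

text \<open>After exchanging the sums, a divisor d costs at most X / d^2 plus a rounding error 1 /
  d; the errors add up to a harmonic number. Even N leaves only odd d \<ge> 3, whose inverse squares
  sum to at most 1/4, whereas over all d \<ge> 2 that sum exceeds 1/2.\<close>

lemma sum_inv_divisor_sum_le:
  fixes N X :: nat
  assumes N: "even N" "N > 0" and X: "X > 0"
  shows "(\<Sum>j<X. inv_divisor_sum (1 + N * j)) \<le> X / 4 + harm (2 * (N * X) + 1)"
proof -
  let ?M = "N * X"
  \<comment> \<open>The odd numbers from 3 to 2 N X + 1: a generous range, as divisors of 1 + N j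
    with j < X are at most 1 + N X.\<close>
  let ?D = "(\<lambda>i. 2 * i + 1) ` {1..?M}"
  have eq: "inv_divisor_sum (1 + N * j) = (\<Sum>d\<in>?D. if d dvd 1 + N * j then 1 / d else 0)" if j: "j < X" for j
  proof -
    have "d \<in> ?D" if d: "d dvd 1 + N * j" "1 < d" for d
    proof -
      have "odd (1 + N * j)" using N by simp
      then have "odd d" using d(1) dvd_trans by blast
      then obtain i where i: "d = 2 * i + 1" by (auto elim: oddE)
      have "d \<le> 1 + N * j" using d(1) by (simp add: dvd_imp_le)
      also have "\<dots> \<le> 1 + N * X" using j by simp
      finally show ?thesis using i d(2) by auto
    qed
    then have "{d. d dvd 1 + N * j \<and> 1 < d} = {d\<in>?D. d dvd 1 + N * j}" by auto
    then show ?thesis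
      by (simp add: inv_divisor_sum_def sum.inter_filter)
  qed
  have inj: "inj_on (\<lambda>i. 2 * i + 1) {1..?M}" by (auto simp: inj_on_def)
  have "(\<Sum>j<X. inv_divisor_sum (1 + N * j)) = (\<Sum>j<X. \<Sum>d\<in>?D. if d dvd 1 + N * j then 1 / d else 0)"
    by (rule sum.cong[OF refl], rule eq) simp
  also have "\<dots> = (\<Sum>d\<in>?D. \<Sum>j<X. if d dvd 1 + N * j then 1 / d else 0)"
    by (rule sum.swap)
  also have "\<dots> = (\<Sum>d\<in>?D. card {j\<in>{..<X}. d dvd 1 + N * j} * (1 / d))"
    by (simp add: sum.inter_filter[symmetric])
  also have "\<dots> \<le> (\<Sum>d\<in>?D. (X / d + 1) * (1 / d))"
    by (intro sum_mono mult_right_mono card_dvd_progression_le) auto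
  also have "\<dots> = (\<Sum>d\<in>?D. X * (1 / (real d)\<^sup>2) + 1 / d)"
    by (intro sum.cong refl) (simp add: power2_eq_square add_divide_distrib)
  also have "\<dots> = X * (\<Sum>d\<in>?D. 1 / (real d)\<^sup>2) + (\<Sum>d\<in>?D. 1 / d)"
    by (simp only: sum.distrib sum_distrib_left)
  finally have "(\<Sum>j<X. inv_divisor_sum (1 + N * j)) \<le>
      X * (\<Sum>d\<in>?D. 1 / (real d)\<^sup>2) + (\<Sum>d\<in>?D. 1 / real d)" .
  moreover have "(\<Sum>d\<in>?D. 1 / (real d)\<^sup>2) \<le> 1/4"
  proof -
    have "(\<Sum>d\<in>?D. 1 / (real d)\<^sup>2) = (\<Sum>i=1..?M. 1 / (2 * real i + 1)\<^sup>2)"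
      unfolding sum.reindex[OF inj] o_def by (simp add: add.commute)
    then show ?thesis using sum_inverse_odd_squares_le[of ?M] by simp
  qed
  then have "X * (\<Sum>d\<in>?D. 1 / (real d)\<^sup>2) \<le> X * (1/4)"
    by (rule mult_left_mono) simp
  moreover have "(\<Sum>d\<in>?D. 1 / real d) \<le> (\<Sum>d=1..2 * ?M + 1. 1 / real d)"
    by (rule sum_mono2) auto
  ultimately show ?thesis
    by (simp add: harm_def inverse_eq_divide)
qed

text \<open>Markov's inequality: once the harmonic error is at most X / 8, the values
  \<open>inv_divisor_sum (1 + N * j)\<close> sum to at most 3 X / 8, so at most 3 X / 4 of them
  exceed 1/2.\<close>

lemma eventually_many_good:
  fixes N :: nat
  assumes N: "even N" "N > 0"
  shows "eventually (\<lambda>X. real X / 4 \<le> card {j\<in>{..<X}. inv_divisor_sum (1 + N * j) \<le> 1/2}) sequentially"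
proof -
  have "eventually (\<lambda>X. real X \<ge> 1 \<and> ln (2 * (N * real X) + 1) + 1 \<le> real X / 8) sequentially"
    using N(2) by (intro eventually_conj) real_asymp+
  then show ?thesis
  proof eventually_elim
    case (elim X)
    let ?S = "\<lambda>j. inv_divisor_sum (1 + N * j)"
    let ?B = "{j\<in>{..<X}. 1/2 < ?S j}" and ?G = "{j\<in>{..<X}. ?S j \<le> 1/2}"
    have nonneg: "0 \<le> ?S j" for j by (auto simp: inv_divisor_sum_def intro: sum_nonneg)
    have "card ?B * (1/2) = (\<Sum>j\<in>?B. 1/2)" by simp
    also have "\<dots> \<le> (\<Sum>j\<in>?B. ?S j)" by (intro sum_mono) auto
    also have "\<dots> \<le> (\<Sum>j<X. ?S j)" using nonneg by (intro sum_mono2) auto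
    also have "\<dots> \<le> X / 4 + harm (2 * (N * X) + 1)"
      using elim by (intro sum_inv_divisor_sum_le N) auto
    \<comment> \<open>The sequence harm n - ln n decreases from its value 1 at n = 1.\<close>
    also have "harm (2 * (N * X) + 1) \<le> ln (2 * (N * real X) + 1) + (1 :: real)"
      using euler_mascheroni_sequence_decreasing[of 1 "2 * (N * X) + 1"]
      by (simp add: harm_expand algebra_simps)
    finally have "real (card ?B) \<le> 3 * X / 4" using elim by simp
    moreover have "{..<X} = ?G \<union> ?B" by auto
    then have "card {..<X} = card ?G + card ?B"
      by (metis (no_types, lifting) card_Un_disjoint finite_Un finite_lessThan disjoint_iff mem_Collect_eq not_less)
    then have "real X = card ?G + card ?B" by simp
    ultimately show ?case by simp
  qed
qed

subsection \<open>Second moments and divergent sums\<close>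

text \<open>If \<open>X\<close> counts the events that occur, then \<open>2 t X - t\<^sup>2 X\<^sup>2 = 1 - (1 - t X)\<^sup>2\<close>
  is at most the indicator of their union.\<close>
lemma measure_Union_ge_second_moment:
  fixes E :: "'i \<Rightarrow> 'a set"
  assumes I: "finite I" and E: "\<And>i. i \<in> I \<Longrightarrow> E i \<in> fmeasurable M"
  shows "2 * t * (\<Sum>i\<in>I. measure M (E i)) - t\<^sup>2 * (\<Sum>i\<in>I. \<Sum>j\<in>I. measure M (E i \<inter> E j))
    \<le> measure M (\<Union>i\<in>I. E i)"
proof -
  define X where "X x = (\<Sum>i\<in>I. indicator (E i) x :: real)" for x
  let ?U = "\<Union>i\<in>I. E i"
  have fin: "emeasure M (E i) < \<infinity>" "E i \<in> sets M" if "i \<in> I" for i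
    using E[OF that] by (auto simp: fmeasurable_def)
  have fin2: "E i \<inter> E j \<in> fmeasurable M" if "i \<in> I" "j \<in> I" for i j
    using that E by (intro fmeasurable_Int_fmeasurable) (auto simp: fmeasurableD)
  have XX: "X x * X x = (\<Sum>i\<in>I. \<Sum>j\<in>I. indicator (E i \<inter> E j) x)" for x
    by (simp add: X_def sum_product indicator_inter_arith)
  have intX: "integrable M X"
    unfolding X_def using fin by (intro Bochner_Integration.integrable_sum integrable_real_indicator) auto
  have intXX: "integrable M (\<lambda>x. X x * X x)"
    unfolding XX using fin2
    by (intro Bochner_Integration.integrable_sum integrable_real_indicator) (auto simp: fmeasurable_def)
  have valX: "(\<integral>x. X x \<partial>M) = (\<Sum>i\<in>I. measure M (E i))"
    unfolding X_def using fin E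
    by (subst Bochner_Integration.integral_sum) (auto intro!: integrable_real_indicator simp: fmeasurableD)
  have valXX: "(\<integral>x. X x * X x \<partial>M) = (\<Sum>i\<in>I. \<Sum>j\<in>I. measure M (E i \<inter> E j))"
  proof -
    have "integrable M (indicator (E i \<inter> E j) :: 'a \<Rightarrow> real)" if "i \<in> I" "j \<in> I" for i j
      using fin2[OF that] by (auto simp: fmeasurable_def)
    moreover have "(\<integral>x. indicator (E i \<inter> E j) x \<partial>M) = measure M (E i \<inter> E j)" if "i \<in> I" "j \<in> I" for i j
      using fin2[OF that] by (simp add: fmeasurable_def Int_absorb2 sets.sets_into_space)
    ultimately show ?thesis
      unfolding XX by (simp add: Bochner_Integration.integral_sum Bochner_Integration.integrable_sum)
  qed
  have U: "?U \<in> fmeasurable M"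
    using I E by (intro fmeasurable.finite_UN) auto
  have "2 * t * (\<integral>x. X x \<partial>M) - t\<^sup>2 * (\<integral>x. X x * X x \<partial>M) =
      (\<integral>x. 2 * t * X x - t\<^sup>2 * (X x * X x) \<partial>M)"
    using intX intXX by simp
  also have "\<dots> \<le> (\<integral>x. indicator ?U x \<partial>M)"
  proof (rule integral_mono)
    show "integrable M (\<lambda>x. 2 * t * X x - t\<^sup>2 * (X x * X x))"
      using intX intXX by simp
    show "integrable M (indicator ?U :: 'a \<Rightarrow> real)"
      using U by (auto simp: fmeasurable_def)
    fix x
    show "2 * t * X x - t\<^sup>2 * (X x * X x) \<le> indicator ?U x"
    proof (cases "x \<in> ?U")
      case True
      have "0 \<le> (1 - t * X x)\<^sup>2" by simp
      then show ?thesis using True by (simp add: power2_eq_square algebra_simps)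
    next
      case False
      then have "X x = 0" by (simp add: X_def)
      then show ?thesis using False by simp
    qed
  qed
  also have "\<dots> = measure M ?U"
    using U by (simp add: fmeasurable_def Int_absorb2 sets.sets_into_space)
  finally show ?thesis by (simp add: valX valXX)
qed

text \<open>The second moment inequality is applied to a finite block K \<le> i < L on which the
  weights sum to A \<ge> c. Every tail union then fills at least the proportion c^2 / 4 of Q, and
  finite measure lets this pass to the decreasing intersection.\<close>

lemma measure_limsup_ge:
  fixes E :: "nat \<Rightarrow> 'a set" and a :: "nat \<Rightarrow> real"
  assumes E: "\<And>i. E i \<in> sets M" "\<And>i. E i \<subseteq> Q" and Q: "Q \<in> fmeasurable M"
    and c: "0 < c" and a: "\<And>i. 0 \<le> a i" "filterlim (\<lambda>L. \<Sum>i<L. a i) at_top sequentially"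
    and lower: "\<And>i. c * a i * measure M Q \<le> measure M (E i)"
    and upper: "\<And>i j. i < j \<Longrightarrow> measure M (E i \<inter> E j) \<le> a i * a j * measure M Q"
  shows "c\<^sup>2 / 4 * measure M Q \<le> measure M (\<Inter>K. \<Union>i\<in>{K..}. E i)"
proof -
  let ?m = "measure M Q" and ?U = "\<lambda>K. \<Union>i\<in>{K..}. E i"
  have Ef: "E i \<in> fmeasurable M" for i
    using fmeasurableI2[OF Q E(2) E(1)] .
  have U: "?U K \<in> fmeasurable M" for K
    using E by (intro fmeasurableI2[OF Q]) auto
  have tail: "c\<^sup>2 / 4 * ?m \<le> measure M (?U K)" for K
  proof -
    have "eventually (\<lambda>L. (\<Sum>i<L. a i) \<ge> (\<Sum>i<K. a i) + c) sequentially"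
      using a(2) by (simp add: filterlim_at_top)
    then have "eventually (\<lambda>L. L \<ge> K \<and> (\<Sum>i<L. a i) \<ge> (\<Sum>i<K. a i) + c) sequentially"
      using eventually_ge_at_top[of K] by eventually_elim auto
    then obtain L where L: "K \<le> L" "(\<Sum>i<L. a i) \<ge> (\<Sum>i<K. a i) + c"
      using eventually_happens'[OF sequentially_bot] by blast
    define A where "A = (\<Sum>i\<in>{K..<L}. a i)"
    have "(\<Sum>i<L. a i) = (\<Sum>i<K. a i) + A"
      using L(1) unfolding A_def by (simp add: lessThan_atLeast0 sum.atLeastLessThan_concat)
    then have A: "c \<le> A" using L(2) by simp
    define S where "S = (\<Sum>i\<in>{K..<L}. measure M (E i))"
    have S: "c * A * ?m \<le> S"
      unfolding A_def S_def sum_distrib_left sum_distrib_right by (intro sum_mono lower)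
    have "(\<Sum>i\<in>{K..<L}. \<Sum>j\<in>{K..<L}. measure M (E i \<inter> E j)) \<le>
        (\<Sum>i\<in>{K..<L}. \<Sum>j\<in>{K..<L}. (if i = j then measure M (E i) else 0) + a i * a j * ?m)"
    proof (intro sum_mono)
      fix i j
      show "measure M (E i \<inter> E j) \<le> (if i = j then measure M (E i) else 0) + a i * a j * ?m"
        using upper[of i j] upper[of j i] a(1) by (cases i j rule: linorder_cases) (auto simp: Int_commute mult_ac)
    qed
    also have "\<dots> = S + A\<^sup>2 * ?m"
    proof -
      have "(\<Sum>i\<in>{K..<L}. \<Sum>j\<in>{K..<L}. a i * a j * ?m) = A\<^sup>2 * ?m"
        by (simp only: A_def power2_eq_square sum_product) (simp only: sum_distrib_right)
      then show ?thesis by (simp add: sum.distrib S_def)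
    qed
    finally have pairs: "(\<Sum>i\<in>{K..<L}. \<Sum>j\<in>{K..<L}. measure M (E i \<inter> E j)) \<le> S + A\<^sup>2 * ?m" .
    \<comment> \<open>Half of the value c / A that would be optimal without the diagonal. As t \<le>
      1, the diagonal sum t^2 S is absorbed by one of the two copies of t S; the other copy leaves
      c^2 / 2 - c^2 / 4, times the measure of Q.\<close>
    define t where "t = c / (2 * A)"
    have t: "0 \<le> t" "t \<le> 1" "t * A = c / 2"
      using A c by (auto simp: t_def field_simps)
    have "t * (c * A * ?m) - t\<^sup>2 * (A\<^sup>2 * ?m) = c * (t * A) * ?m - (t * A)\<^sup>2 * ?m"
      by (simp add: power_mult_distrib)
    then have "c\<^sup>2 / 4 * ?m = t * (c * A * ?m) - t\<^sup>2 * (A\<^sup>2 * ?m)"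
      unfolding t(3) by (simp add: power2_eq_square)
    also have "t * (c * A * ?m) \<le> t * S"
      using S t by (intro mult_left_mono) auto
    also have "t * S \<le> 2 * t * S - t\<^sup>2 * S"
    proof -
      have "0 \<le> S" by (simp add: S_def sum_nonneg)
      then have "0 \<le> t * (1 - t) * S" using t by simp
      then show ?thesis by (simp add: power2_eq_square algebra_simps)
    qed
    also have "2 * t * S - t\<^sup>2 * S - t\<^sup>2 * (A\<^sup>2 * ?m) = 2 * t * S - t\<^sup>2 * (S + A\<^sup>2 * ?m)"
      by (simp add: algebra_simps)
    also have "\<dots> \<le> 2 * t * S - t\<^sup>2 * (\<Sum>i\<in>{K..<L}. \<Sum>j\<in>{K..<L}. measure M (E i \<inter> E j))"
      using pairs by (simp add: mult_left_mono)
    also have "\<dots> \<le> measure M (\<Union>i\<in>{K..<L}. E i)"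
      unfolding S_def by (rule measure_Union_ge_second_moment) (auto simp: Ef)
    also have "\<dots> \<le> measure M (?U K)"
      using U E by (intro measure_mono_fmeasurable) auto
    finally show ?thesis by simp
  qed
  have "(\<lambda>K. measure M (?U K)) \<longlonglongrightarrow> measure M (\<Inter>K. ?U K)"
  proof (rule Lim_measure_decseq)
    show "range ?U \<subseteq> sets M" using U by (auto simp: fmeasurableD)
    show "decseq ?U" by (force simp: decseq_def)
    show "emeasure M (?U i) \<noteq> \<infinity>" for i
      using U[of i] by (auto simp: fmeasurable_def)
  qed
  then show ?thesis
    by (rule LIMSEQ_le_const) (use tail in blast)
qed

text \<open>With s < 1/2, truncation keeps intervals about distinct integers disjoint. If \<psi>
  ever drops to s, monotonicity confines the change to finitely many terms; otherwise every
  truncated term equals s^n.\<close>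

lemma filterlim_sum_min_at_top:
  fixes \<psi> :: "nat \<Rightarrow> real"
  assumes pos: "\<And>j. 1 \<le> j \<Longrightarrow> 0 < \<psi> j"
    and noninc: "\<And>i j. 1 \<le> i \<Longrightarrow> i \<le> j \<Longrightarrow> \<psi> j \<le> \<psi> i"
    and div: "filterlim (\<lambda>N. \<Sum>j=1..N. \<psi> j ^ n) at_top sequentially" and s: "0 < s"
  shows "filterlim (\<lambda>N. \<Sum>j=1..N. (min (\<psi> j) s) ^ n) at_top sequentially"
proof (cases "\<exists>J\<ge>1. \<psi> J \<le> s")
  case True
  then obtain J where J: "J \<ge> 1" "\<psi> J \<le> s" by blast
  define g where "g j = (min (\<psi> j) s) ^ n" for j
  define D where "D = (\<Sum>j=1..J. \<psi> j ^ n)"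
  have "filterlim (\<lambda>N. - D + (\<Sum>j=1..N. \<psi> j ^ n)) at_top sequentially"
    by (rule filterlim_tendsto_add_at_top[OF tendsto_const div])
  then show ?thesis
  proof (rule filterlim_at_top_mono)
    show "\<forall>\<^sub>F N in sequentially. - D + (\<Sum>j=1..N. \<psi> j ^ n) \<le> (\<Sum>j=1..N. (min (\<psi> j) s) ^ n)"
      using eventually_ge_at_top[of J]
    proof eventually_elim
      case (elim N)
      have split: "{1..N} = {1..J} \<union> {J<..N}" using elim J by auto
      have "(\<Sum>j=1..N. \<psi> j ^ n) = D + (\<Sum>j\<in>{J<..N}. \<psi> j ^ n)"
        unfolding split D_def by (rule sum.union_disjoint) auto
      also have "(\<Sum>j\<in>{J<..N}. \<psi> j ^ n) = (\<Sum>j\<in>{J<..N}. (min (\<psi> j) s) ^ n)"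
      proof (rule sum.cong)
        fix j assume "j \<in> {J<..N}"
        then have "\<psi> j \<le> s" using noninc[of J j] J by auto
        then show "\<psi> j ^ n = min (\<psi> j) s ^ n" by (simp add: min_def)
      qed simp
      also have "\<dots> \<le> (\<Sum>j=1..N. (min (\<psi> j) s) ^ n)"
      proof (rule sum_mono2)
        fix j assume "j \<in> {1..N} - {J<..N}"
        then have "0 < \<psi> j" using pos by simp
        then show "0 \<le> min (\<psi> j) s ^ n" using s by simp
      qed (use J in auto)
      finally show ?case by simp
    qed
  qed
next
  case False
  have const: "(\<Sum>j=1..N. (min (\<psi> j) s) ^ n) = s ^ n * real N" for N
  proof -
    have "(\<Sum>j=1..N. (min (\<psi> j) s) ^ n) = (\<Sum>j=1..N. s ^ n)"
      using False by (intro sum.cong refl) (simp add: min_def)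
    then show ?thesis by simp
  qed
  show ?thesis
    unfolding const using s
    by (intro filterlim_tendsto_pos_mult_at_top[OF tendsto_const _ filterlim_real_sequentially]) simp
qed

text \<open>Monotonicity bounds the \<beta> terms that follow position \<alpha> + \<beta> j by
  \<beta> times the term there, so thinning costs only the factor \<beta> and the constant
  \<open>C\<close>.\<close>

lemma filterlim_sum_progression_at_top:
  fixes g :: "nat \<Rightarrow> real"
  assumes noninc: "\<And>i j. 1 \<le> i \<Longrightarrow> i \<le> j \<Longrightarrow> g j \<le> g i"
    and div: "filterlim (\<lambda>N. \<Sum>j=1..N. g j) at_top sequentially" and ab: "1 \<le> \<alpha>" "1 \<le> \<beta>"
  shows "filterlim (\<lambda>X. \<Sum>j<X. g (\<alpha> + \<beta> * j)) at_top sequentially"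
proof -
  define C where "C = (\<Sum>j=1..\<alpha>. g j)"
  have le: "(\<Sum>j=1..\<alpha> + \<beta> * X. g j) \<le> C + \<beta> * (\<Sum>j<X. g (\<alpha> + \<beta> * j))" for X
  proof (induction X)
    case (Suc X)
    have split: "{1..\<alpha> + \<beta> * Suc X} = {1..\<alpha> + \<beta> * X} \<union> {\<alpha> + \<beta> * X<..\<alpha> + \<beta> * X + \<beta>}" by auto
    have "(\<Sum>j\<in>{\<alpha> + \<beta> * X<..\<alpha> + \<beta> * X + \<beta>}. g j) \<le> (\<Sum>j\<in>{\<alpha> + \<beta> * X<..\<alpha> + \<beta> * X + \<beta>}. g (\<alpha> + \<beta> * X))"
      using ab by (intro sum_mono noninc) auto
    then have "(\<Sum>j\<in>{\<alpha> + \<beta> * X<..\<alpha> + \<beta> * X + \<beta>}. g j) \<le> \<beta> * g (\<alpha> + \<beta> * X)" by simp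
    moreover have "(\<Sum>j=1..\<alpha> + \<beta> * Suc X. g j) =
        (\<Sum>j=1..\<alpha> + \<beta> * X. g j) + (\<Sum>j\<in>{\<alpha> + \<beta> * X<..\<alpha> + \<beta> * X + \<beta>}. g j)"
      unfolding split by (rule sum.union_disjoint) auto
    ultimately show ?case using Suc by (simp add: algebra_simps)
  qed (simp add: C_def)
  have "filterlim (\<lambda>X. \<alpha> + \<beta> * X) at_top sequentially"
    using ab by (intro filterlim_subseq strict_monoI) auto
  then have "filterlim (\<lambda>X. \<Sum>j=1..\<alpha> + \<beta> * X. g j) at_top sequentially"
    by (rule filterlim_compose[OF div])
  then have "filterlim (\<lambda>X. (1 / \<beta>) * (- C + (\<Sum>j=1..\<alpha> + \<beta> * X. g j))) at_top sequentially"
    using ab by (intro filterlim_tendsto_pos_mult_at_top[OF tendsto_const]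
      filterlim_tendsto_add_at_top[OF tendsto_const]) auto
  then show ?thesis
  proof (rule filterlim_at_top_mono)
    show "\<forall>\<^sub>F X in sequentially. (1 / \<beta>) * (- C + (\<Sum>j=1..\<alpha> + \<beta> * X. g j)) \<le> (\<Sum>j<X. g (\<alpha> + \<beta> * j))"
      using ab le by (intro always_eventually allI) (simp add: field_simps)
  qed
qed

text \<open>Abel summation against \<open>indicator G - \<delta>\<close>, whose partial sums are bounded below.\<close>
lemma filterlim_sum_positive_density_at_top:
  fixes f :: "nat \<Rightarrow> real"
  assumes noninc: "\<And>i j. i \<le> j \<Longrightarrow> f j \<le> f i" and nonneg: "\<And>j. 0 \<le> f j"
    and div: "filterlim (\<lambda>X. \<Sum>j<X. f j) at_top sequentially"
    and \<delta>: "0 < \<delta>" and dens: "eventually (\<lambda>X. \<delta> * real X \<le> card {j\<in>{..<X}. j \<in> G}) sequentially"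
  shows "filterlim (\<lambda>X. \<Sum>j<X. if j \<in> G then f j else 0) at_top sequentially"
proof -
  define u where "u j = (if j \<in> G then 1 else 0) - \<delta>" for j
  from dens obtain X0 where X0: "\<And>X. X \<ge> X0 \<Longrightarrow> \<delta> * real X \<le> card {j\<in>{..<X}. j \<in> G}"
    by (auto simp: eventually_sequentially)
  \<comment> \<open>Before \<open>X0\<close> the partial sums of \<open>u\<close> may be negative,
    but they never fall below - \<delta> X0.\<close>
  define B where "B = \<delta> * X0"
  have u_sum: "(\<Sum>j<X. u j) = card {j\<in>{..<X}. j \<in> G} - \<delta> * X" for X
    by (simp add: u_def sum_subtractf sum.inter_filter[symmetric])
  have U: "0 \<le> (\<Sum>j<X. u j) + B" for X
  proof (cases "X \<ge> X0")
    case True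
    then show ?thesis using X0[OF True] \<delta> by (simp add: u_sum B_def)
  next
    case False
    then have "\<delta> * X \<le> B" using \<delta> by (simp add: B_def)
    then show ?thesis by (simp add: u_sum)
  qed
  \<comment> \<open>Adding \<open>B\<close> makes the partial sums nonnegative, so replacing f X by
    the smaller f (Suc X) only lowers the left side; the new term then appears equally on both
    sides.\<close>
  have abel: "((\<Sum>j<Suc X. u j) + B) * f X \<le> (\<Sum>j<Suc X. u j * f j) + B * f 0" for X
  proof (induction X)
    case (Suc X)
    have "((\<Sum>j<Suc X. u j) + B) * f (Suc X) \<le> ((\<Sum>j<Suc X. u j) + B) * f X"
      using U[of "Suc X"] noninc by (intro mult_left_mono) auto
    with Suc show ?case by (simp add: algebra_simps)
  qed (simp add: algebra_simps)
  have lower: "\<delta> * (\<Sum>j<X. f j) - B * f 0 \<le> (\<Sum>j<X. if j \<in> G then f j else 0)" for X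
  proof (cases X)
    case 0
    then show ?thesis using nonneg \<delta> by (simp add: B_def)
  next
    case (Suc Y)
    have "0 \<le> ((\<Sum>j<Suc Y. u j) + B) * f Y"
      using U nonneg by (intro mult_nonneg_nonneg)
    also note abel
    also have "(\<Sum>j<Suc Y. u j * f j) = (\<Sum>j<X. if j \<in> G then f j else 0) - \<delta> * (\<Sum>j<X. f j)"
      unfolding Suc sum_distrib_left sum_subtractf[symmetric]
      by (rule sum.cong) (auto simp: u_def algebra_simps)
    finally show ?thesis by simp
  qed
  have "filterlim (\<lambda>X. - (B * f 0) + \<delta> * (\<Sum>j<X. f j)) at_top sequentially"
    by (intro filterlim_tendsto_add_at_top[OF tendsto_const]
      filterlim_tendsto_pos_mult_at_top[OF tendsto_const \<delta> div])
  then show ?thesis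
    by (rule filterlim_at_top_mono) (intro always_eventually allI, use lower in simp)
qed

subsection \<open>Density on dyadic cubes\<close>

text \<open>By outer regularity U may exceed S by less than e in measure, so m \<le> d (m + e) for
  all e > 0; as d < 1 and m is finite, m = 0.\<close>

lemma null_set_if_small_in_open_supersets:
  fixes S :: "'a::euclidean_space set"
  assumes S: "S \<in> lmeasurable" and d: "d < 1"
    and le: "\<And>U. open U \<Longrightarrow> S \<subseteq> U \<Longrightarrow> emeasure lebesgue S \<le> ennreal d * emeasure lebesgue U"
  shows "S \<in> null_sets lebesgue"
proof -
  \<comment> \<open>\<open>ennreal\<close> sends a negative d to 0, so \<open>max d 0\<close> is the
    factor that really occurs.\<close>
  let ?m = "measure lebesgue S" and ?d = "max d 0"
  have m: "emeasure lebesgue S = ennreal ?m"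
    using S by (simp add: emeasure_eq_measure2)
  have bound: "?m \<le> ?d * (?m + e)" if e: "e > 0" for e
  proof -
    obtain U where U: "open U" "S \<subseteq> U" "U - S \<in> lmeasurable" "emeasure lebesgue (U - S) < ennreal e"
      using sets_lebesgue_outer_open[of S e] S e by auto
    have "emeasure lebesgue U = emeasure lebesgue S + emeasure lebesgue (U - S)"
      using U S by (subst plus_emeasure) (auto simp: Un_absorb1)
    also have "\<dots> \<le> ennreal (?m + e)"
      using U(4) e by (simp add: m add_left_mono less_imp_le)
    finally have "ennreal ?m \<le> ennreal d * ennreal (?m + e)"
      using le[OF U(1,2)] by (metis m mult_left_mono order_trans zero_le)
    also have "\<dots> = ennreal (?d * (?m + e))"
      using e by (cases "d \<ge> 0") (simp_all add: ennreal_mult max_def ennreal_neg)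
    finally show ?thesis
      using e by (subst (asm) ennreal_le_iff) auto
  qed
  have "?m * (1 - ?d) \<le> e" if e: "e > 0" for e
  proof -
    have "?m \<le> ?d * (?m + e)" using bound[OF e] .
    moreover have "?d * e \<le> 1 * e"
      using d e by (intro mult_right_mono) auto
    ultimately show ?thesis by (simp add: algebra_simps)
  qed
  then have "?m * (1 - ?d) \<le> 0"
    by (rule field_le_epsilon[of _ 0, simplified])
  moreover have "1 - ?d > 0"
    using d by auto
  ultimately have "?m \<le> 0"
    by (metis mult_le_0_iff not_less)
  then show ?thesis
    using S m by (simp add: null_sets_def fmeasurableD antisym[OF _ measure_nonneg])
qed

text \<open>Cover the complement of \<open>W\<close> by dyadic cubes inside an open set of nearly the same measure.\<close>
lemma AE_of_cube_density:
  fixes W :: "'a::euclidean_space set"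
  assumes W: "W \<in> sets lebesgue" and d: "d < 1"
    and cube: "\<And>(u::'a) v k. (\<And>b. b \<in> Basis \<Longrightarrow> v \<bullet> b - u \<bullet> b = 1 / 2 ^ k) \<Longrightarrow>
      emeasure lebesgue (cbox u v - W) \<le> ennreal d * emeasure lebesgue (cbox u v)"
  shows "AE x in lebesgue. x \<in> W"
proof -
  have null: "cbox a (a + One) - W \<in> null_sets lebesgue" for a
  proof (rule null_set_if_small_in_open_supersets[OF _ d])
    let ?S = "cbox a (a + One) - W"
    show "?S \<in> lmeasurable"
      using W by (intro fmeasurable_Diff) auto
    fix U assume U: "open U" "?S \<subseteq> U"
    \<comment> \<open>Each cube chosen by the covering lemma lies in \<open>g x\<close> for some x
      of \<open>?S\<close>, hence in U.\<close>
    define g where "g x = (if x \<in> ?S then U else UNIV)" for x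
    have g: "gauge g"
      using U by (auto simp: gauge_def g_def)
    have S: "?S \<subseteq> cbox a (a + One)" "box a (a + One) \<noteq> {}"
      by (auto simp: box_ne_empty inner_add_left)
    obtain D where D: "countable D"
        "\<And>K. K \<in> D \<Longrightarrow> interior K \<noteq> {} \<and> (\<exists>c d. K = cbox c d)"
        "pairwise (\<lambda>A B. interior A \<inter> interior B = {}) D"
        "\<And>K. K \<in> D \<Longrightarrow> \<exists>x \<in> ?S \<inter> K. K \<subseteq> g x"
        "\<And>u v. cbox u v \<in> D \<Longrightarrow> \<exists>n. \<forall>i \<in> Basis. v \<bullet> i - u \<bullet> i = ((a + One) \<bullet> i - a \<bullet> i) / 2^n"
        "?S \<subseteq> \<Union>D"
      by (rule covering_lemma[OF S g]) blast
    \<comment> \<open>The cubes may share boundary points. Passing to interiors makes the measures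
      add up, at the price of a countable union of null frontiers.\<close>
    have int_eq: "emeasure lebesgue (interior K) = emeasure lebesgue K" if "K \<in> D" for K
      using D(2)[OF that] by (auto simp: interior_cbox emeasure_lborel_box_eq emeasure_lborel_cbox_eq)
    have front: "frontier K \<in> null_sets lebesgue" if "K \<in> D" for K
    proof -
      obtain c d where "K = cbox c d" using D(2) \<open>K \<in> D\<close> by blast
      then show ?thesis
        using negligible_frontier_interval[of c d] by (simp add: negligible_iff_null_sets frontier_cbox)
    qed
    have meas: "K \<in> sets lebesgue" if "K \<in> D" for K
      using D(2)[OF that] by auto
    have "disjoint_family_on interior D"
      using D(3) by (auto simp: disjoint_family_on_def pairwise_def)
    note UN = emeasure_UN_countable[OF _ D(1) this, of lebesgue]
    have disj: "disjoint_family_on (\<lambda>K. interior K - W) D"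
      using \<open>disjoint_family_on interior D\<close> by (auto simp: disjoint_family_on_def)
    have Z: "(\<Union>K\<in>D. frontier K) \<in> null_sets lebesgue"
      using D(1) front by (rule null_sets_UN')
    have "emeasure lebesgue ?S \<le> emeasure lebesgue ((\<Union>K\<in>D. interior K - W) \<union> (\<Union>K\<in>D. frontier K))"
    proof (rule emeasure_mono)
      show "?S \<subseteq> (\<Union>K\<in>D. interior K - W) \<union> (\<Union>K\<in>D. frontier K)"
      proof
        fix x assume x: "x \<in> ?S"
        then obtain K where K: "K \<in> D" "x \<in> K" using D(6) by blast
        then have "x \<in> interior K \<or> x \<in> frontier K"
          using closure_subset by (auto simp: frontier_def)
        then show "x \<in> (\<Union>K\<in>D. interior K - W) \<union> (\<Union>K\<in>D. frontier K)"
          using K x by blast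
      qed
      show "(\<Union>K\<in>D. interior K - W) \<union> (\<Union>K\<in>D. frontier K) \<in> sets lebesgue"
        using Z W D(1) by (intro sets.Un sets.countable_UN' sets.Diff) auto
    qed
    also have "\<dots> = emeasure lebesgue (\<Union>K\<in>D. interior K - W)"
      using Z W D(1) by (intro emeasure_Un_null_set sets.countable_UN' sets.Diff) auto
    also have "\<dots> = (\<integral>\<^sup>+K. emeasure lebesgue (interior K - W) \<partial>count_space D)"
      using W by (intro emeasure_UN_countable D(1) disj sets.Diff) auto
    also have "\<dots> \<le> (\<integral>\<^sup>+K. ennreal d * emeasure lebesgue (interior K) \<partial>count_space D)"
    proof (rule nn_integral_mono)
      fix K assume "K \<in> space (count_space D)"
      then have K: "K \<in> D" by simp
      then obtain u v where uv: "K = cbox u v" using D(2) by blast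
      with D(5) K obtain n where "\<forall>i\<in>Basis. v \<bullet> i - u \<bullet> i = ((a + One) \<bullet> i - a \<bullet> i) / 2^n" by blast
      then have "emeasure lebesgue (cbox u v - W) \<le> ennreal d * emeasure lebesgue (cbox u v)"
        by (intro cube[where k = n]) (auto simp: inner_add_left)
      moreover have "emeasure lebesgue (interior K - W) \<le> emeasure lebesgue (K - W)"
        using W meas[OF K] by (intro emeasure_mono) (auto dest: subsetD[OF interior_subset])
      ultimately show "emeasure lebesgue (interior K - W) \<le> ennreal d * emeasure lebesgue (interior K)"
        using int_eq[OF K] uv by simp
    qed
    also have "\<dots> = ennreal d * emeasure lebesgue (\<Union>K\<in>D. interior K)"
      by (subst UN) (auto simp: nn_integral_cmult)
    also have "\<dots> \<le> ennreal d * emeasure lebesgue U"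
    proof -
      have "(\<Union>K\<in>D. interior K) \<subseteq> U"
      proof
        fix x assume "x \<in> (\<Union>K\<in>D. interior K)"
        then obtain K where K: "K \<in> D" "x \<in> interior K" by blast
        with D(4) obtain z where "z \<in> ?S" "K \<subseteq> g z" by blast
        then show "x \<in> U" using K interior_subset by (auto simp: g_def)
      qed
      then show ?thesis
        using U by (intro mult_left_mono emeasure_mono) auto
    qed
    finally show "emeasure lebesgue ?S \<le> ennreal d * emeasure lebesgue U" .
  qed
  \<comment> \<open>Unit cubes with integer corners: countably many, covering the whole
    space.\<close>
  let ?Z = "\<Union>f\<in>Basis \<rightarrow>\<^sub>E (\<int>::real set). cbox (\<Sum>b\<in>Basis. f b *\<^sub>R b) ((\<Sum>b\<in>Basis. f b *\<^sub>R b) + One) - W"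
  have "?Z \<in> null_sets lebesgue"
    by (intro null_sets_UN' null countable_PiE) (auto simp: Ints_def)
  moreover have "- W \<subseteq> ?Z"
  proof
    fix x assume x: "x \<in> - W"
    define f where "f = (\<lambda>b\<in>Basis. of_int \<lfloor>x \<bullet> b\<rfloor> :: real)"
    have "f \<in> Basis \<rightarrow>\<^sub>E \<int>" by (auto simp: f_def)
    moreover have "x \<in> cbox (\<Sum>b\<in>Basis. f b *\<^sub>R b) ((\<Sum>b\<in>Basis. f b *\<^sub>R b) + One)"
      by (auto simp: mem_box f_def inner_add_left intro: less_imp_le)
    ultimately show "x \<in> ?Z" using x by blast
  qed
  ultimately show ?thesis
    by (intro AE_I'[of ?Z]) auto
qed

subsection \<open>Product events on cubes\<close>

lemma nn_integral_lborel_vec_prod: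
  fixes f :: "'n::finite \<Rightarrow> real \<Rightarrow> ennreal"
  assumes [measurable]: "\<And>i. f i \<in> borel_measurable borel"
  shows "(\<integral>\<^sup>+x. (\<Prod>i\<in>UNIV. f i (x $ i)) \<partial>(lborel :: (real ^ 'n) measure)) = (\<Prod>i\<in>UNIV. (\<integral>\<^sup>+t. f i t \<partial>lborel))"
proof -
  let ?e = "\<lambda>i::'n. axis i (1::real)"
  have inj: "inj ?e" by (auto simp: inj_on_def axis_eq_axis)
  have Basis: "(Basis :: (real ^ 'n) set) = range ?e" by (auto simp: Basis_vec_def)
  have inv: "inv ?e (?e i) = i" for i by (rule inv_f_f[OF inj])
  have "(\<integral>\<^sup>+x. (\<Prod>b\<in>Basis. f (inv ?e b) (x \<bullet> b)) \<partial>(lborel :: (real ^ 'n) measure)) =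
      (\<Prod>b\<in>(Basis :: (real ^ 'n) set). (\<integral>\<^sup>+t. f (inv ?e b) t \<partial>lborel))"
    by (rule nn_integral_lborel_prod) auto
  then show ?thesis
    unfolding Basis prod.reindex[OF inj] o_def inv by (simp add: cart_eq_inner_axis)
qed

lemma prod_mono_ennreal:
  fixes f g :: "'a \<Rightarrow> ennreal"
  assumes "\<And>i. i \<in> A \<Longrightarrow> f i \<le> g i"
  shows "prod f A \<le> prod g A"
  using assms by (induction A rule: infinite_finite_induct) (auto intro!: mult_mono)

lemma prod_indicator_UNIV:
  "(\<Prod>i\<in>UNIV. indicator (S i) (f i)) = (if \<forall>i::'n::finite. f i \<in> S i then 1 else (0::ennreal))"
  by (auto simp: indicator_def)

lemma coordinates_measurable:
  fixes S :: "'n::finite \<Rightarrow> (real \<times> real) set"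
  assumes [measurable]: "\<And>i. S i \<in> sets (borel \<Otimes>\<^sub>M borel)"
  shows "{z :: (real ^ 'n) \<times> (real ^ 'n). \<forall>i. (fst z $ i, snd z $ i) \<in> S i} \<in> sets (borel \<Otimes>\<^sub>M borel)"
proof -
  have [measurable]: "(\<lambda>x::real ^ 'n. x $ i) \<in> borel_measurable borel" for i
    by (intro borel_measurable_continuous_onI continuous_intros)
  have "{z \<in> space (borel \<Otimes>\<^sub>M borel). \<forall>i. (fst z $ i, snd (z :: (real ^ 'n) \<times> (real ^ 'n)) $ i) \<in> S i} \<in> sets (borel \<Otimes>\<^sub>M borel)"
    by measurable
  then show ?thesis
    by (simp add: space_pair_measure)
qed

text \<open>The coordinates are grouped into pairs (x_i, y_i). For fixed y the x-integral factors
  over i, and the result is again a product of functions of the single y_i, so it factors a second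
  time.\<close>

lemma emeasure_lborel_coordinates:
  fixes S :: "'n::finite \<Rightarrow> (real \<times> real) set"
  assumes S [measurable]: "\<And>i. S i \<in> sets (borel \<Otimes>\<^sub>M borel)"
  shows "emeasure lborel {z :: (real ^ 'n) \<times> (real ^ 'n). \<forall>i. (fst z $ i, snd z $ i) \<in> S i} =
    (\<Prod>i\<in>UNIV. (\<integral>\<^sup>+y. (\<integral>\<^sup>+x. indicator (S i) (x, y) \<partial>lborel) \<partial>lborel))"
proof -
  let ?E = "{z :: (real ^ 'n) \<times> (real ^ 'n). \<forall>i. (fst z $ i, snd z $ i) \<in> S i}"
  have [measurable]: "(\<lambda>x::real ^ 'n. x $ i) \<in> borel_measurable borel" for i
    by (intro borel_measurable_continuous_onI continuous_intros)
  have ind: "indicator ?E z = (\<Prod>i\<in>UNIV. indicator (S i) (fst z $ i, snd z $ i) :: ennreal)" for z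
    unfolding prod_indicator_UNIV by (simp add: indicator_def)
  have meas [measurable]: "(\<lambda>z::(real ^ 'n) \<times> (real ^ 'n). \<Prod>i\<in>UNIV. indicator (S i) (fst z $ i, snd z $ i) :: ennreal)
      \<in> borel_measurable (lborel \<Otimes>\<^sub>M lborel)"
    by measurable
  have E: "?E \<in> sets (lborel \<Otimes>\<^sub>M lborel)"
    using coordinates_measurable[OF S] by (simp cong: sets_pair_measure_cong)
  have "emeasure lborel ?E = emeasure (lborel \<Otimes>\<^sub>M lborel) ?E"
    by (simp only: lborel_prod)
  also have "\<dots> = (\<integral>\<^sup>+z. indicator ?E z \<partial>(lborel \<Otimes>\<^sub>M lborel))"
    using E by simp
  also have "\<dots> = (\<integral>\<^sup>+z. (\<Prod>i\<in>UNIV. indicator (S i) (fst z $ i, snd z $ i)) \<partial>(lborel \<Otimes>\<^sub>M lborel))"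
    by (simp only: ind)
  also have "\<dots> = (\<integral>\<^sup>+y. (\<integral>\<^sup>+x. (\<Prod>i\<in>UNIV. indicator (S i) (x $ i, y $ i)) \<partial>lborel) \<partial>lborel)"
    by (subst lborel_pair.nn_integral_snd[symmetric]) (use meas in auto)
  also have "\<dots> = (\<integral>\<^sup>+y. (\<Prod>i\<in>UNIV. (\<integral>\<^sup>+s. indicator (S i) (s, y $ i) \<partial>lborel)) \<partial>(lborel :: (real ^ 'n) measure))"
    by (intro nn_integral_cong nn_integral_lborel_vec_prod) measurable
  also have "\<dots> = (\<Prod>i\<in>UNIV. (\<integral>\<^sup>+t. (\<integral>\<^sup>+s. indicator (S i) (s, t) \<partial>lborel) \<partial>lborel))"
    by (rule nn_integral_lborel_vec_prod) measurable
  finally show ?thesis .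
qed

text \<open>Modulus P and multiplier q are separate parameters: the estimate for pairs ignores the
  moduli, and the estimate for single events takes P = q / N.\<close>

definition cop_event :: "nat \<Rightarrow> nat \<Rightarrow> real \<Rightarrow> ((real ^ 'n) \<times> (real ^ 'n)) set" where
  "cop_event P q r = {z. \<forall>i. real q * fst z $ i - snd z $ i \<in> cop_nbhd P r}"

lemma cop_event_borel [measurable]: "cop_event P q r \<in> sets (borel :: ((real ^ 'n::finite) \<times> (real ^ 'n)) measure)"
proof -
  have coord [measurable]: "(\<lambda>z::(real ^ 'n) \<times> (real ^ 'n). real q * fst z $ i - snd z $ i) \<in> borel_measurable borel" for i
    by (intro borel_measurable_continuous_onI continuous_intros)
  show ?thesis
    unfolding cop_event_def by measurable
qed

lemma mem_cube_iff:
  fixes u v z :: "(real ^ 'n::finite) \<times> (real ^ 'n)"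
  assumes "\<And>b. b \<in> Basis \<Longrightarrow> v \<bullet> b - u \<bullet> b = l"
  shows "z \<in> cbox u v \<longleftrightarrow>
    (\<forall>i. fst z $ i \<in> {fst u $ i..fst u $ i + l} \<and> snd z $ i \<in> {snd u $ i..snd u $ i + l})"
proof -
  have "(axis i 1, 0) \<in> (Basis :: ((real ^ 'n) \<times> (real ^ 'n)) set)"
    "(0, axis i 1) \<in> (Basis :: ((real ^ 'n) \<times> (real ^ 'n)) set)" for i
    by (simp_all add: Basis_prod_def axis_in_Basis_iff)
  then have "fst v $ i = fst u $ i + l" "snd v $ i = snd u $ i + l" for i
    using assms[of "(axis i 1, 0)"] assms[of "(0, axis i 1)"]
    by (simp_all add: inner_prod_def cart_eq_inner_axis)
  moreover have "z \<in> cbox u v \<longleftrightarrow> fst z \<in> cbox (fst u) (fst v) \<and> snd z \<in> cbox (snd u) (snd v)"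
    by (metis cbox_Pair_eq mem_Times_iff prod.collapse)
  ultimately show ?thesis
    by (auto simp: mem_box_cart)
qed

lemma emeasure_cube:
  fixes u v :: "(real ^ 'n::finite) \<times> (real ^ 'n)"
  assumes "\<And>b. b \<in> Basis \<Longrightarrow> v \<bullet> b - u \<bullet> b = l" and l: "0 \<le> l"
  shows "emeasure lborel (cbox u v) = ennreal ((l * l) ^ CARD('n))"
proof -
  have "emeasure lborel (cbox u v) = ennreal (\<Prod>b\<in>Basis. (v - u) \<bullet> b)"
  proof (rule emeasure_lborel_cbox)
    fix b :: "(real ^ 'n) \<times> (real ^ 'n)" assume "b \<in> Basis"
    from assms(1)[OF this] l show "u \<bullet> b \<le> v \<bullet> b" by linarith
  qed
  also have "(\<Prod>b\<in>Basis. (v - u) \<bullet> b) = (\<Prod>b\<in>(Basis :: ((real ^ 'n) \<times> (real ^ 'n)) set). l)"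
    using assms(1) by (intro prod.cong refl) (simp add: inner_diff_left)
  also have "\<dots> = (l * l) ^ CARD('n)"
    by (simp add: power_add power_mult_distrib)
  finally show ?thesis .
qed

lemma nn_integral_indicator_rectangle:
  fixes A :: "(real \<times> real) set"
  shows "(\<integral>\<^sup>+y. (\<integral>\<^sup>+x. indicator {p\<in>I \<times> J. p \<in> A} (x, y) \<partial>lborel) \<partial>lborel) =
    (\<integral>\<^sup>+y\<in>J. (\<integral>\<^sup>+x\<in>I. indicator A (x, y) \<partial>lborel) \<partial>lborel)"
proof (rule nn_integral_cong)
  fix y :: real
  show "(\<integral>\<^sup>+x. indicator {p\<in>I \<times> J. p \<in> A} (x, y) \<partial>lborel) =
      (\<integral>\<^sup>+x\<in>I. indicator A (x, y) \<partial>lborel) * indicator J y"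
    by (cases "y \<in> J") (auto simp: indicator_def intro!: nn_integral_cong)
qed

text \<open>The factor \<kappa> is lost once in each of the n coordinates. Relative to the volume
  N^(-2n) of the cube the bound is (2 r \<kappa>)^n.\<close>

lemma emeasure_cop_event_ge:
  fixes u v :: "(real ^ 'n::finite) \<times> (real ^ 'n)" and r :: real and N m :: nat
  assumes cube: "\<And>b. b \<in> Basis \<Longrightarrow> v \<bullet> b - u \<bullet> b = 1 / real N"
    and N: "N > 0" and m: "m > 0" and r: "0 \<le> r" "r < 1/2"
    and tot: "\<kappa> \<le> totient (N * m) / (N * m)" and \<kappa>: "0 \<le> \<kappa>"
  shows "ennreal ((2 * r * \<kappa> / (N * N)) ^ CARD('n)) \<le>
    emeasure lborel (cop_event (N * m) (N\<^sup>2 * m) r \<inter> cbox u v)"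
proof -
  let ?I = "\<lambda>i. {fst u $ i..fst u $ i + 1 / real N}" and ?J = "\<lambda>i. {snd u $ i..snd u $ i + 1 / real N}"
  let ?A = "{p. real (N\<^sup>2 * m) * fst p - snd p \<in> cop_nbhd (N * m) r}"
  let ?S = "\<lambda>i::'n. {p\<in>?I i \<times> ?J i. p \<in> ?A}"
  have S: "?S i \<in> sets (borel \<Otimes>\<^sub>M borel)" for i
    by measurable
  have ind: "indicator ?A (x, y) = (indicator (cop_nbhd (N * m) r) (real (N\<^sup>2 * m) * x - y) :: ennreal)" for x y
    by (simp add: indicator_def)
  have eq: "cop_event (N * m) (N\<^sup>2 * m) r \<inter> cbox u v = {z. \<forall>i. (fst z $ i, snd z $ i) \<in> ?S i}"
    using mem_cube_iff[OF cube] by (auto simp: cop_event_def)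
  have "ennreal ((2 * r * \<kappa> / (N * N)) ^ CARD('n)) = (\<Prod>i\<in>(UNIV :: 'n set). ennreal (2 * r * \<kappa> / (N * N)))"
    using r \<kappa> by (simp add: ennreal_power)
  also have "\<dots> \<le> (\<Prod>i\<in>(UNIV :: 'n set). (\<integral>\<^sup>+y\<in>?J i. (\<integral>\<^sup>+x\<in>?I i. indicator ?A (x, y) \<partial>lborel) \<partial>lborel))"
  proof (rule prod_mono_ennreal)
    fix i :: 'n
    have "ennreal (2 * r * \<kappa> / (N * N)) \<le> ennreal (2 * r * (totient (N * m) / (N * m)) / (N * N))"
      using tot r by (intro ennreal_leI divide_right_mono mult_left_mono) auto
    also have "\<dots> \<le> (\<integral>\<^sup>+y\<in>?J i. (\<integral>\<^sup>+x\<in>?I i. indicator ?A (x, y) \<partial>lborel) \<partial>lborel)"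
      unfolding ind by (rule nn_integral_cop_nbhd_block_ge[OF N m r])
    finally show "ennreal (2 * r * \<kappa> / (N * N)) \<le> (\<integral>\<^sup>+y\<in>?J i. (\<integral>\<^sup>+x\<in>?I i. indicator ?A (x, y) \<partial>lborel) \<partial>lborel)" .
  qed
  also have "\<dots> = emeasure lborel (cop_event (N * m) (N\<^sup>2 * m) r \<inter> cbox u v)"
    unfolding eq emeasure_lborel_coordinates[OF S] nn_integral_indicator_rectangle ..
  finally show ?thesis .
qed

text \<open>The moduli are arbitrary because both neighbourhoods are enlarged to modulus 1. Relative
  to the cube the bound is (2 r)^n (2 r')^n, as for independent events.\<close>

lemma emeasure_cop_event_pair_le:
  fixes u v :: "(real ^ 'n::finite) \<times> (real ^ 'n)" and r r' :: real and N j j' :: nat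
  assumes cube: "\<And>b. b \<in> Basis \<Longrightarrow> v \<bullet> b - u \<bullet> b = 1 / real N"
    and N: "N > 0" and j: "j < j'" and r: "0 \<le> r" "r < 1/2" and r': "0 \<le> r'" "r' < 1/2"
    and q: "q = N\<^sup>2 * (1 + N * j)" "q' = N\<^sup>2 * (1 + N * j')"
  shows "emeasure lborel (cop_event P q r \<inter> cop_event P' q' r' \<inter> cbox u v) \<le>
    ennreal ((2 * r * (2 * r') / (N * N)) ^ CARD('n))"
proof -
  let ?I = "\<lambda>i. {fst u $ i..fst u $ i + 1 / real N}" and ?J = "\<lambda>i. {snd u $ i..snd u $ i + 1 / real N}"
  let ?A = "{p. real q * fst p - snd p \<in> cop_nbhd 1 r \<and> real q' * fst p - snd p \<in> cop_nbhd 1 r'}"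
  let ?S = "\<lambda>i::'n. {p\<in>?I i \<times> ?J i. p \<in> ?A}"
  have S: "?S i \<in> sets (borel \<Otimes>\<^sub>M borel)" for i
    by measurable
  have "emeasure lborel (cop_event P q r \<inter> cop_event P' q' r' \<inter> cbox u v) \<le>
      emeasure lborel {z. \<forall>i. (fst z $ i, snd z $ i) \<in> ?S i}"
  proof (intro emeasure_mono subsetI)
    fix z assume "z \<in> cop_event P q r \<inter> cop_event P' q' r' \<inter> cbox u v"
    then show "z \<in> {z. \<forall>i. (fst z $ i, snd z $ i) \<in> ?S i}"
      using mem_cube_iff[OF cube, of z] cop_nbhd_subset[of P r] cop_nbhd_subset[of P' r'] by (auto simp: cop_event_def simp del: One_nat_def)
  qed (simp only: sets_lborel borel_prod[symmetric], rule coordinates_measurable[OF S])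
  also have "\<dots> = (\<Prod>i\<in>(UNIV :: 'n set). (\<integral>\<^sup>+y\<in>?J i. (\<integral>\<^sup>+x\<in>?I i. indicator ?A (x, y) \<partial>lborel) \<partial>lborel))"
    unfolding emeasure_lborel_coordinates[OF S] nn_integral_indicator_rectangle ..
  also have "\<dots> \<le> (\<Prod>i\<in>(UNIV :: 'n set). ennreal (2 * r * (2 * r') / (N * N)))"
  proof (rule prod_mono_ennreal)
    fix i :: 'n
    have ind: "indicator ?A (x, y) = (indicator (cop_nbhd 1 r) (real q * x - y) *
        indicator (cop_nbhd 1 r') (real q' * x - y) :: ennreal)" for x y
      by (simp add: indicator_def)
    show "(\<integral>\<^sup>+y\<in>?J i. (\<integral>\<^sup>+x\<in>?I i. indicator ?A (x, y) \<partial>lborel) \<partial>lborel) \<le> ennreal (2 * r * (2 * r') / (N * N))"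
      unfolding ind by (rule nn_integral_cop_nbhd_pair_le[OF r r' j N q])
  qed
  also have "\<dots> = ennreal ((2 * r * (2 * r') / (N * N)) ^ CARD('n))"
    using r r' by (simp add: ennreal_power)
  finally show ?thesis .
qed

subsection \<open>The limsup set\<close>

text \<open>The power of two contributes a factor of at least 1/2, and the odd part another 1/2 by
  \<open>totient_ge_inv_divisor_sum\<close>.\<close>

lemma totient_ratio_ge:
  assumes m: "odd m" "inv_divisor_sum m \<le> 1/2"
  shows "1/4 \<le> totient (2 ^ k * m) / real (2 ^ k * m)"
proof -
  have pos: "0 < m" using m(1) by (cases m) auto
  have "real (2 ^ k) / 2 \<le> totient (2 ^ k)"
    by (cases k) (simp_all add: totient_power_Suc del: power_Suc, simp)
  moreover have "real m / 2 \<le> totient m"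
  proof -
    have "real m * (1/2) \<le> real m * (1 - inv_divisor_sum m)"
      using m(2) by (intro mult_left_mono) auto
    with totient_ge_inv_divisor_sum[OF pos] show ?thesis by simp
  qed
  ultimately have "(real (2 ^ k) / 2) * (real m / 2) \<le> real (totient (2 ^ k)) * totient m"
    by (intro mult_mono) auto
  also have "\<dots> = totient (2 ^ k * m)"
    using m(1) by (subst totient_mult_coprime) auto
  finally show ?thesis
    using pos by (simp add: field_simps)
qed

text \<open>The even multiplier 2 j keeps this number odd also for k = 0.\<close>

definition dyadic_modulus :: "nat \<Rightarrow> nat \<Rightarrow> nat" where
  "dyadic_modulus k j = 1 + 2 ^ k * (2 * j)"

text \<open>\<open>2\<^sup>k m\<close> has the same prime factors as the denominator \<open>4\<^sup>k m\<close>; as the modulus it gives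
  \<open>cop_nbhd\<close> the shorter period.\<close>
definition dyadic_event :: "(nat \<Rightarrow> real) \<Rightarrow> nat \<Rightarrow> nat \<Rightarrow> ((real ^ 'n) \<times> (real ^ 'n)) set" where
  "dyadic_event \<rho> k j = (if inv_divisor_sum (dyadic_modulus k j) \<le> 1/2
     then cop_event (2 ^ k * dyadic_modulus k j) ((2 ^ k)\<^sup>2 * dyadic_modulus k j)
       (\<rho> ((2 ^ k)\<^sup>2 * dyadic_modulus k j)) else {})"

lemma dyadic_event_borel [measurable]:
  "dyadic_event \<rho> k j \<in> sets (borel :: ((real ^ 'n::finite) \<times> (real ^ 'n)) measure)"
  by (simp add: dyadic_event_def)

text \<open>The proportion depends neither on k nor on the cube, as the density argument requires;
  it is c^2 / 4 from \<open>measure_limsup_ge\<close> with c = (1/4)^n.\<close>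

lemma measure_limsup_dyadic_event_ge:
  fixes \<rho> :: "nat \<Rightarrow> real" and u v :: "(real ^ 'n::finite) \<times> (real ^ 'n)"
  assumes \<rho>: "\<And>j. 1 \<le> j \<Longrightarrow> 0 \<le> \<rho> j" "\<And>j. \<rho> j < 1/2"
    and noninc: "\<And>i j. 1 \<le> i \<Longrightarrow> i \<le> j \<Longrightarrow> \<rho> j \<le> \<rho> i"
    and div: "filterlim (\<lambda>N. \<Sum>j=1..N. \<rho> j ^ CARD('n)) at_top sequentially"
    and cube: "\<And>b. b \<in> Basis \<Longrightarrow> v \<bullet> b - u \<bullet> b = 1 / 2 ^ k"
  shows "((1/4) ^ CARD('n))\<^sup>2 / 4 * measure lborel (cbox u v) \<le>
    measure lborel ((\<Inter>K. \<Union>j\<in>{K..}. dyadic_event \<rho> k j) \<inter> cbox u v)"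
proof -
  define N :: nat where "N = 2 ^ k"
  define n where "n = CARD('n)"
  let ?m = "dyadic_modulus k"
  define q where "q j = N\<^sup>2 * ?m j" for j
  define G where "G = {j. inv_divisor_sum (?m j) \<le> 1/2}"
  \<comment> \<open>(2 \<rho>)^n is the proportion expected without coprimality: products of these
    weights bound intersections from above, and (1/4)^n times the weight bounds a single event from
    below. Indices outside \<open>G\<close> have empty events and weight 0.\<close>
  define a where "a j = (if j \<in> G then (2 * \<rho> (q j)) ^ n else 0)" for j
  have N: "N > 0" by (simp add: N_def)
  have m: "?m j = 1 + N * (2 * j)" "odd (?m j)" "0 < ?m j" for j
    by (simp_all add: dyadic_modulus_def N_def)
  have q: "q j = N\<^sup>2 + 2 * N * N\<^sup>2 * j" "1 \<le> q j" for j
    using N m(3)[of j] by (simp add: q_def m algebra_simps, simp add: q_def Suc_le_eq)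
  have cube': "v \<bullet> b - u \<bullet> b = 1 / real N" if "b \<in> Basis" for b
    using cube[OF that] by (simp add: N_def)
  have E: "dyadic_event \<rho> k j = (if j \<in> G then cop_event (N * ?m j) (q j) (\<rho> (q j)) else {})" for j
    by (simp add: dyadic_event_def N_def q_def G_def)
  have Qm: "measure lborel (cbox u v) = (1 / (real N * real N)) ^ n"
    using emeasure_cube[OF cube'] N by (simp add: measure_def n_def)
  have "((1/4) ^ n)\<^sup>2 / 4 * measure lborel (cbox u v) \<le>
      measure lborel (\<Inter>K. \<Union>j\<in>{K..}. dyadic_event \<rho> k j \<inter> cbox u v)"
  proof (rule measure_limsup_ge[where a = a])
    show a_nonneg: "0 \<le> a j" for j
      using \<rho>(1) q(2) by (simp add: a_def)
    \<comment> \<open>Divergence survives two thinnings: to the progression of all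
      \<open>q j\<close>, and then to the j in \<open>G\<close>, whose lower density is at least
      1/4.\<close>
    have "filterlim (\<lambda>X. \<Sum>j<X. \<rho> (N\<^sup>2 + 2 * N * N\<^sup>2 * j) ^ n) at_top sequentially"
      using N \<rho>(1) noninc div[folded n_def]
      by (intro filterlim_sum_progression_at_top[where g = "\<lambda>j. \<rho> j ^ n"] power_mono) auto
    then have "filterlim (\<lambda>X. \<Sum>j<X. if j \<in> G then \<rho> (q j) ^ n else 0) at_top sequentially"
    proof (intro filterlim_sum_positive_density_at_top[where \<delta> = "1/4"])
      show "\<rho> (q j) ^ n \<le> \<rho> (q i) ^ n" if "i \<le> j" for i j
        using that q \<rho>(1) by (intro power_mono noninc) auto
      show "\<forall>\<^sub>F X in sequentially. 1 / 4 * real X \<le> card {j\<in>{..<X}. j \<in> G}"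
        using eventually_many_good[of "2 * N"] N by (simp add: G_def m mult_ac)
    qed (use \<rho>(1) q in auto)
    then have "filterlim (\<lambda>X. 2 ^ n * (\<Sum>j<X. if j \<in> G then \<rho> (q j) ^ n else 0)) at_top sequentially"
      by (rule filterlim_tendsto_pos_mult_at_top[OF tendsto_const, rotated]) simp
    moreover have "2 ^ n * (\<Sum>j<X. if j \<in> G then \<rho> (q j) ^ n else 0) = (\<Sum>j<X. a j)" for X
      unfolding sum_distrib_left by (intro sum.cong) (auto simp: a_def power_mult_distrib)
    ultimately show "filterlim (\<lambda>X. \<Sum>j<X. a j) at_top sequentially" by simp
    show "(1/4) ^ n * a j * measure lborel (cbox u v) \<le> measure lborel (dyadic_event \<rho> k j \<inter> cbox u v)" for j
    proof (cases "j \<in> G")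
      case True
      have "ennreal ((2 * \<rho> (q j) * (1/4) / (N * N)) ^ n) \<le> emeasure lborel (dyadic_event \<rho> k j \<inter> cbox u v)"
        using emeasure_cop_event_ge[OF cube' N m(3)[of j], of "\<rho> (q j)" "1/4"] True \<rho> q
          totient_ratio_ge[OF m(2)[of j], of k]
        by (simp add: E q_def n_def G_def N_def)
      also have "emeasure lborel (dyadic_event \<rho> k j \<inter> cbox u v) =
          ennreal (measure lborel (dyadic_event \<rho> k j \<inter> cbox u v))"
        by (intro emeasure_eq_measure2 fmeasurableI2[OF fmeasurable_cbox]) auto
      also have "2 * \<rho> (q j) * (1/4) / (N * N) = (1/4) * (2 * \<rho> (q j)) * (1 / (real N * real N))"
        by simp
      also have "\<dots> ^ n = (1/4) ^ n * a j * measure lborel (cbox u v)"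
        unfolding power_mult_distrib Qm a_def using True by (simp only: if_True power_mult_distrib)
      finally show ?thesis by simp
    next
      case False
      then show ?thesis by (simp add: a_def)
    qed
    show "measure lborel (dyadic_event \<rho> k i \<inter> cbox u v \<inter> (dyadic_event \<rho> k j \<inter> cbox u v)) \<le>
        a i * a j * measure lborel (cbox u v)" if "i < j" for i j
    proof (cases "i \<in> G \<and> j \<in> G")
      case True
      have eq: "dyadic_event \<rho> k i \<inter> cbox u v \<inter> (dyadic_event \<rho> k j \<inter> cbox u v) =
          cop_event (N * ?m i) (q i) (\<rho> (q i)) \<inter> cop_event (N * ?m j) (q j) (\<rho> (q j)) \<inter> cbox u v" (is "_ = ?B")
        using True by (auto simp: E)
      have "ennreal (measure lborel ?B) = emeasure lborel ?B"
        by (intro emeasure_eq_measure2[symmetric] fmeasurableI2[OF fmeasurable_cbox]) auto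
      also have "\<dots> \<le> ennreal ((2 * \<rho> (q i) * (2 * \<rho> (q j)) / (N * N)) ^ n)"
        unfolding n_def using that \<rho> q(2)
        by (intro emeasure_cop_event_pair_le[OF cube' N, of "2 * i" "2 * j"]) (auto simp: q_def m)
      also have "2 * \<rho> (q i) * (2 * \<rho> (q j)) / (N * N) = (2 * \<rho> (q i)) * (2 * \<rho> (q j)) * (1 / (real N * real N))"
        by simp
      also have "\<dots> ^ n = a i * a j * measure lborel (cbox u v)"
        unfolding power_mult_distrib Qm a_def using True by (simp only: if_True power_mult_distrib)
      finally show ?thesis
        unfolding eq using a_nonneg by (subst (asm) ennreal_le_iff) simp_all
    next
      case False
      then show ?thesis by (auto simp: a_def E)
    qed
  qed auto
  also have "(\<Inter>K. \<Union>j\<in>{K..}. dyadic_event \<rho> k j \<inter> cbox u v) =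
      (\<Inter>K. \<Union>j\<in>{K..}. dyadic_event \<rho> k j) \<inter> cbox u v"
    by auto
  finally show ?thesis by (simp add: n_def)
qed

text \<open>A common divisor divides q and any single p_i, so coprimality in one coordinate already
  gives gcd 1.\<close>

lemma dyadic_event_primitive:
  assumes "(\<theta>, y) \<in> dyadic_event \<rho> k j"
  obtains p :: "int ^ 'n::finite"
  where "Gcd (insert (int ((2 ^ k)\<^sup>2 * dyadic_modulus k j)) (range (\<lambda>i. p $ i))) = 1"
    "(MAX i. \<bar>of_int (int ((2 ^ k)\<^sup>2 * dyadic_modulus k j)) * \<theta> $ i + of_int (p $ i) - y $ i\<bar>) \<le>
      \<rho> ((2 ^ k)\<^sup>2 * dyadic_modulus k j)"
proof -
  let ?m = "dyadic_modulus k j"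
  let ?q = "(2 ^ k)\<^sup>2 * ?m"
  have "\<forall>i. \<exists>p::int. coprime p (int (2 ^ k * ?m)) \<and> \<bar>real ?q * \<theta> $ i - y $ i + of_int p\<bar> \<le> \<rho> ?q"
    using assms by (auto simp: dyadic_event_def cop_event_def cop_nbhd_def split: if_splits)
  then obtain f where f: "\<And>i. coprime (f i) (int (2 ^ k * ?m))"
      "\<And>i. \<bar>real ?q * \<theta> $ i - y $ i + of_int (f i)\<bar> \<le> \<rho> ?q"
    by metis
  define p :: "int ^ 'n" where "p = (\<chi> i. f i)"
  have "coprime (p $ i) (int ?q)" for i
    using f(1)[of i] by (simp add: p_def power2_eq_square)
  then have "is_unit (Gcd (insert (int ?q) (range (\<lambda>i. p $ i))))"
    by (meson Gcd_dvd coprime_common_divisor insertI1 insertI2 rangeI)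
  then have "Gcd (insert (int ?q) (range (\<lambda>i. p $ i))) = 1"
    by (metis normalize_1_iff normalize_Gcd)
  moreover have "(MAX i. \<bar>of_int (int ?q) * \<theta> $ i + of_int (p $ i) - y $ i\<bar>) \<le> \<rho> ?q"
  proof (subst Max_le_iff; safe?)
    fix i
    show "\<bar>of_int (int ?q) * \<theta> $ i + of_int (p $ i) - y $ i\<bar> \<le> \<rho> ?q"
      using f(2)[of i] by (simp add: p_def algebra_simps)
  qed auto
  ultimately show ?thesis by (rule that)
qed

theorem corollary1p4:
  fixes \<psi> :: "nat \<Rightarrow> real"
  assumes pos: "\<And>j. j \<ge> 1 \<Longrightarrow> \<psi> j > 0"
    and noninc: "\<And>i j. 1 \<le> i \<Longrightarrow> i \<le> j \<Longrightarrow> \<psi> j \<le> \<psi> i"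
    and div: "filterlim (\<lambda>N. \<Sum>j=1..N. \<psi> j ^ CARD('n::finite)) at_top sequentially"
  shows "AE (\<theta>, y) in (lebesgue :: ((real ^ 'n) \<times> (real ^ 'n)) measure).
           infinite {(q :: int, p :: int ^ 'n). q \<noteq> 0 \<and>
             Gcd (insert q (range (\<lambda>i. p $ i))) = 1 \<and>
             (MAX i. \<bar>of_int q * \<theta> $ i + of_int (p $ i) - y $ i\<bar>) \<le> \<psi> (nat \<bar>q\<bar>)}"
proof -
  \<comment> \<open>The cap 1/4 lies below 1/2, and a smaller radius only shrinks the events, so
    solutions for \<rho> are solutions for \<psi>.\<close>
  define \<rho> where "\<rho> j = min (\<psi> j) (1/4)" for j
  define V :: "nat \<Rightarrow> ((real ^ 'n) \<times> (real ^ 'n)) set"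
    where "V k = (\<Inter>K. \<Union>j\<in>{K..}. dyadic_event \<rho> k j)" for k
  define c :: real where "c = ((1/4) ^ CARD('n))\<^sup>2 / 4"
  have V [measurable]: "V k \<in> sets borel" for k
    unfolding V_def by (intro sets.countable_INT'' sets.countable_UN') auto
  have c: "0 < c" by (simp add: c_def)
  \<comment> \<open>\<open>V k\<close> is controlled only on cubes of side 2^(-k); the union over k
    is one set that is dense enough at every dyadic scale.\<close>
  have "AE z in lebesgue. z \<in> (\<Union>k. V k)"
  proof (rule AE_of_cube_density)
    show "1 - c < 1" using c by simp
    show "(\<Union>k. V k) \<in> sets lebesgue" by (intro sets_completionI_sets) (auto simp: sets_lborel)
    fix u v :: "(real ^ 'n) \<times> (real ^ 'n)" and k
    assume cube: "\<And>b. b \<in> Basis \<Longrightarrow> v \<bullet> b - u \<bullet> b = 1 / 2 ^ k"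
    have VQ: "c * measure lborel (cbox u v) \<le> measure lborel (V k \<inter> cbox u v)"
      unfolding c_def V_def
    proof (rule measure_limsup_dyadic_event_ge[OF _ _ _ _ cube])
      show "filterlim (\<lambda>N. \<Sum>j=1..N. \<rho> j ^ CARD('n)) at_top sequentially"
        unfolding \<rho>_def by (rule filterlim_sum_min_at_top[OF pos noninc div]) auto
      show "\<rho> j \<le> \<rho> i" if "1 \<le> i" "i \<le> j" for i j
        using noninc[OF that] by (auto simp: \<rho>_def min_def)
    qed (use pos in \<open>auto simp: \<rho>_def less_imp_le min_less_iff_disj\<close>)
    have fm: "cbox u v \<in> fmeasurable lborel" "V k \<inter> cbox u v \<in> fmeasurable lborel" "cbox u v - V k \<in> fmeasurable lborel"
      by (auto intro: fmeasurableI2[OF fmeasurable_cbox])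
    have "measure lborel (cbox u v - V k) = measure lborel (cbox u v) - measure lborel (V k \<inter> cbox u v)"
      by (subst measurable_measure_Diff[symmetric]) (auto simp: Diff_Int)
    then have "measure lborel (cbox u v - V k) \<le> (1 - c) * measure lborel (cbox u v)"
      using VQ by (simp add: algebra_simps)
    then have "emeasure lborel (cbox u v - V k) \<le> ennreal ((1 - c) * measure lborel (cbox u v))"
      using fm(3) by (simp add: emeasure_eq_measure2 ennreal_leI)
    also have "\<dots> = ennreal (1 - c) * emeasure lborel (cbox u v)"
      using fm(1) by (simp add: emeasure_eq_measure2 ennreal_mult'')
    finally have "emeasure lborel (cbox u v - V k) \<le> ennreal (1 - c) * emeasure lborel (cbox u v)" .
    moreover have "emeasure lborel (cbox u v - (\<Union>k. V k)) \<le> emeasure lborel (cbox u v - V k)"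
      by (intro emeasure_mono) auto
    ultimately show "emeasure lebesgue (cbox u v - (\<Union>k. V k)) \<le> ennreal (1 - c) * emeasure lebesgue (cbox u v)"
      by simp
  qed
  then show ?thesis
  proof (rule AE_mp, intro AE_I2 impI)
    fix z assume "z \<in> (\<Union>k. V k)"
    then obtain k where k: "z \<in> V k" by blast
    obtain \<theta> y where z: "z = (\<theta>, y)" by (cases z)
    let ?q = "\<lambda>j. (2 ^ k)\<^sup>2 * dyadic_modulus k j"
    let ?S = "{(q :: int, p :: int ^ 'n). q \<noteq> 0 \<and>
             Gcd (insert q (range (\<lambda>i. p $ i))) = 1 \<and>
             (MAX i. \<bar>of_int q * \<theta> $ i + of_int (p $ i) - y $ i\<bar>) \<le> \<psi> (nat \<bar>q\<bar>)}"
    let ?J = "{j. (\<theta>, y) \<in> dyadic_event \<rho> k j}"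
    have "infinite ?J"
      using k by (auto simp: infinite_nat_iff_unbounded_le V_def z)
    \<comment> \<open>Distinct j give distinct denominators, so infinitely many j make the
      projection of the solution set to q infinite.\<close>
    moreover have "inj_on (\<lambda>j. int (?q j)) ?J"
      by (auto simp: inj_on_def dyadic_modulus_def)
    ultimately have "infinite ((\<lambda>j. int (?q j)) ` ?J)"
      using finite_imageD by blast
    moreover have "(\<lambda>j. int (?q j)) ` ?J \<subseteq> fst ` ?S"
    proof safe
      fix j assume "(\<theta>, y) \<in> dyadic_event \<rho> k j"
      then obtain p :: "int ^ 'n" where p: "Gcd (insert (int (?q j)) (range (\<lambda>i. p $ i))) = 1"
        "(MAX i. \<bar>of_int (int (?q j)) * \<theta> $ i + of_int (p $ i) - y $ i\<bar>) \<le> \<rho> (?q j)"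
        by (rule dyadic_event_primitive)
      have "\<rho> (?q j) \<le> \<psi> (nat \<bar>int (?q j)\<bar>)"
        unfolding \<rho>_def abs_of_nat nat_int by simp
      note le = order_trans[OF p(2) this]
      have "int (?q j) \<noteq> 0"
        unfolding of_nat_eq_0_iff by (simp add: dyadic_modulus_def)
      then have "(int (?q j), p) \<in> ?S"
        unfolding mem_Collect_eq case_prod_conv using p(1) le by (intro conjI)
      then show "int (?q j) \<in> fst ` ?S" by (rule rev_image_eqI) simp
    qed
    ultimately have "infinite (fst ` ?S)"
      by (rule infinite_super[rotated])
    then have "infinite ?S"
      by (rule contrapos_nn) (rule finite_imageI)
    then show "case z of (\<theta>, y) \<Rightarrow> infinite {(q :: int, p :: int ^ 'n). q \<noteq> 0 \<and>
             Gcd (insert q (range (\<lambda>i. p $ i))) = 1 \<and>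
             (MAX i. \<bar>of_int q * \<theta> $ i + of_int (p $ i) - y $ i\<bar>) \<le> \<psi> (nat \<bar>q\<bar>)}"
      unfolding z by simp
  qed
qed

end
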